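(* Let $y(t)$ be the exact solution of $y'(t)=Ay(t)+g(y(t))$ with $y(t_0)=y_0\in\mathbb{R}^d$ ($t_0=0$), where $A=QM$, $g(y)=Q\nabla V(y)$, $Q$ is an invertible real $d\times d$ matrix, $M$ is a symmetric real $d\times d$ matrix and $V:\mathbb{R}^d\to\mathbb{R}$. Let $\tilde u(\tau)$, $\tau\in[0,1]$, be the function produced by one step of size $h$ of the ECr method from $y_0$. Then, as $h\to0$, the stage order and order of the method are given by $$\tilde u(\tau)-y(t_0+\tau h)=\mathcal{O}(h^{r+1}),\quad 0<\tau<1,$$ $$\tilde u(1)-y(t_0+h)=\mathcal{O}(h^{2r+1}).$$
   Context: Function spaces. Fix an integer $r\ge1$ and fixed ($h$-independent) sufficiently smooth real functions $\varphi_0,\dots,\varphi_{r-1}$ of time. For a stepsize $h>0$ and any function $\varphi$ write $\tilde\varphi(\tau)=\varphi(\tau h)$, $\tau\in[0,1]$. The functions $\tilde\varphi_0,\dots,\tilde\varphi_{r-1}$ are assumed linearly independent on $[0,1]$. Define $$Y_h=\Big\{\tilde w:\ \tilde w(\tau)=\sum_{i=0}^{r-1}\tilde\varphi_i(\tau)W_i,\ \tau\in[0,1],\ W_i\in\mathbb{R}^d\Big\}.$$ Let $\langle w_1,w_2\rangle=\int_0^1 w_1(\tau)\cdot w_2(\tau)\,d\tau$, let $\tilde\psi_0,\dots,\tilde\psi_{r-1}$ be an orthonormal basis of $\mathrm{span}\{\tilde\varphi_0,\dots,\tilde\varphi_{r-1}\}$ for this inner product, and $P_{\tau,\sigma}=\sum_{i=0}^{r-1}\tilde\psi_i(\tau)\tilde\psi_i(\sigma)$.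 The orthogonal projection onto $Y_h$ is $\mathcal{P}_h\tilde w(\tau)=\int_0^1P_{\tau,\sigma}\tilde w(\sigma)\,d\sigma$. ECr method. One step of size $h$ from $y_0$ is $$\tilde u(\tau)=e^{\tau hA}y_0+\tau h\int_0^1\bar A_{\tau,\sigma}(A)\,g(\tilde u(\sigma))\,d\sigma,\qquad y_1=\tilde u(1),$$ $$\bar A_{\tau,\sigma}(A)=\int_0^1e^{(1-\xi)\tau hA}P_{\xi\tau,\sigma}\,d\xi .$$ Equivalently, writing $\tilde u(\tau)=u(\tau h)$ and $\tilde u'(\tau)=u'(\tau h)$, one has $\tilde u(0)=y_0$ and $\tilde u'(\tau)=A\tilde u(\tau)+\mathcal{P}_hg(\tilde u(\tau))$. Conventions. $V$ is sufficiently smooth (e.g. $C^\infty$). For sufficiently small $h$, $\tilde u$ is the unique solution with values in a ball of fixed radius about $e^{\tau hA}y_0$; it depends smoothly on $h$. An $h$-dependent function $w(\tau)$ is called regular if $w(\tau)=\sum_{n=0}^{r-1}w^{[n]}(\tau)h^n+\mathcal{O}(h^r)$ with each $w^{[n]}(\tau)=\frac1{n!}\frac{\partial^n w(\tau)}{\partial h^n}\big|_{h=0}$ having polynomial entries in $\tau$ of degree $\le n$. The spaces $Y_h$ have the following properties, recalled from the literature: $P_{\tau,\sigma}$ extends smoothly in $h$ to $h=0$ by its limit, and $\mathcal{P}_hw-w=\mathcal{O}(h^r)$ for every regular $w$. *)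

theory Defs
  imports "HOL-Analysis.Analysis" "HOL-Library.Landau_Symbols"
begin

text \<open>
  Matrix power and exponential for the product \<open>**\<close>; the overloaded product and power on vectors
  are componentwise.
\<close>

primrec matpow :: "real^'n^'n \<Rightarrow> nat \<Rightarrow> real^'n^'n" where
  "matpow B 0 = mat 1"
| "matpow B (Suc k) = B ** matpow B k"

definition mexp :: "real^'n^'n \<Rightarrow> real^'n^'n" where
  "mexp B = (\<Sum>k. matpow B k /\<^sub>R fact k)"

text \<open>\<open>C\<^sup>k\<close> functions, for open \<open>S\<close>.\<close>

primrec Ck_on :: "nat \<Rightarrow> 'a::real_normed_vector set \<Rightarrow> ('a \<Rightarrow> 'b::real_normed_vector) \<Rightarrow> bool" where
  "Ck_on 0 S f \<longleftrightarrow> continuous_on S f"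
| "Ck_on (Suc k) S f \<longleftrightarrow>
     (\<forall>x\<in>S. f differentiable (at x)) \<and> (\<forall>v. Ck_on k S (\<lambda>x. frechet_derivative f (at x) v))"

definition smooth_on :: "'a::real_normed_vector set \<Rightarrow> ('a \<Rightarrow> 'b::real_normed_vector) \<Rightarrow> bool" where
  "smooth_on S f \<longleftrightarrow> (\<forall>k. Ck_on k S f)"

text \<open>
  \<open>f h \<tau> = O(h\<^sup>k)\<close> as \<open>h\<close> decreases to \<open>0\<close>, uniformly in \<open>\<tau> \<in> T\<close>.
\<close>

definition unif_bigo :: "real set \<Rightarrow> (real \<Rightarrow> real \<Rightarrow> 'a::real_normed_vector) \<Rightarrow> nat \<Rightarrow> bool" where
  "unif_bigo T f k \<longleftrightarrow> (\<exists>C. \<forall>\<^sub>F h in at_right 0. \<forall>\<tau>\<in>T. norm (f h \<tau>) \<le> C * h ^ k)"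

definition inner01 :: "(real \<Rightarrow> 'a::real_inner) \<Rightarrow> (real \<Rightarrow> 'a) \<Rightarrow> real" where
  "inner01 v w = integral {0..1} (\<lambda>\<tau>. v \<tau> \<bullet> w \<tau>)"

text \<open>
  Functions on \<open>[0,1]\<close> are represented by total functions whose values elsewhere are irrelevant.
\<close>

definition span01 :: "nat \<Rightarrow> (nat \<Rightarrow> real \<Rightarrow> real) \<Rightarrow> (real \<Rightarrow> real) set" where
  "span01 r f = {w. \<exists>c. \<forall>\<tau>\<in>{0..1}. w \<tau> = (\<Sum>i<r. c i * f i \<tau>)}"

definition lin_indep01 :: "nat \<Rightarrow> (nat \<Rightarrow> real \<Rightarrow> real) \<Rightarrow> bool" where
  "lin_indep01 r f \<longleftrightarrow> (\<forall>c. (\<forall>\<tau>\<in>{0..1}. (\<Sum>i<r. c i * f i \<tau>) = 0) \<longrightarrow> (\<forall>i<r. c i = 0))"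

definition orthonormal_basis01 ::
    "nat \<Rightarrow> (nat \<Rightarrow> real \<Rightarrow> real) \<Rightarrow> (nat \<Rightarrow> real \<Rightarrow> real) \<Rightarrow> bool" where
  "orthonormal_basis01 r \<psi> f \<longleftrightarrow>
     span01 r \<psi> = span01 r f \<and>
     (\<forall>i<r. \<forall>j<r. inner01 (\<psi> i) (\<psi> j) = (if i = j then 1 else 0))"

text \<open>
  The kernel \<open>P\<^bsub>\<tau>,\<sigma>\<^esub>\<close> and the projection \<open>\<P>\<^sub>h\<close> onto \<open>Y\<^sub>h\<close>, for an orthonormal basis \<open>\<psi>\<close>
  belonging to one fixed stepsize.
\<close>

definition Pker :: "nat \<Rightarrow> (nat \<Rightarrow> real \<Rightarrow> real) \<Rightarrow> real \<Rightarrow> real \<Rightarrow> real" where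
  "Pker r \<psi> \<tau> \<sigma> = (\<Sum>i<r. \<psi> i \<tau> * \<psi> i \<sigma>)"

definition proj :: "nat \<Rightarrow> (nat \<Rightarrow> real \<Rightarrow> real) \<Rightarrow> (real \<Rightarrow> real^'n) \<Rightarrow> real \<Rightarrow> real^'n" where
  "proj r \<psi> w \<tau> = integral {0..1} (\<lambda>\<sigma>. Pker r \<psi> \<tau> \<sigma> *\<^sub>R w \<sigma>)"

text \<open>
  \<open>W n h \<tau>\<close> is the \<open>n\<close>-th derivative of \<open>w\<close> in \<open>h\<close>, one-sided at \<open>h = 0\<close>, so that
  \<open>W n 0 \<tau> / n!\<close> is the expansion coefficient \<open>w\<^sup>[\<^sup>n\<^sup>](\<tau>)\<close>.  Continuity in \<open>\<tau>\<close> is part of the notion,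
  because the projection of a non-integrable function is meaningless (it would be \<open>0\<close>).
\<close>

definition regular :: "nat \<Rightarrow> (real \<Rightarrow> real \<Rightarrow> real^'n) \<Rightarrow> bool" where
  "regular r w \<longleftrightarrow> (\<exists>\<delta>>0. \<exists>W.
     (\<forall>h\<in>{0..\<delta>}. continuous_on {0..1} (w h)) \<and>
     (\<forall>h\<in>{0..\<delta>}. \<forall>\<tau>\<in>{0..1}. W 0 h \<tau> = w h \<tau>) \<and>
     (\<forall>n. Suc n < r \<longrightarrow> (\<forall>h\<in>{0..\<delta>}. \<forall>\<tau>\<in>{0..1}.
        ((\<lambda>\<eta>. W n \<eta> \<tau>) has_vector_derivative W (Suc n) h \<tau>) (at h within {0..\<delta>}))) \<and>
     (\<forall>n<r. \<forall>i. \<exists>p::real poly. degree p \<le> n \<and> (\<forall>\<tau>\<in>{0..1}. (W n 0 \<tau> /\<^sub>R fact n) $ i = poly p \<tau>)) \<and>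
     unif_bigo {0..1} (\<lambda>h \<tau>. w h \<tau> - (\<Sum>n<r. h ^ n *\<^sub>R (W n 0 \<tau> /\<^sub>R fact n))) r)"

text \<open>
  The kernel of the bases \<open>\<psi> h\<close>, \<open>0 < h \<le> h0\<close>, extends smoothly in \<open>h\<close> to \<open>h = 0\<close>:
  \<open>D n\<close> is the \<open>n\<close>-th \<open>h\<close>-derivative of the extension, and \<open>D 0 0\<close> is the limit kernel.
\<close>

definition kernel_extends_smoothly :: "nat \<Rightarrow> real \<Rightarrow> (real \<Rightarrow> nat \<Rightarrow> real \<Rightarrow> real) \<Rightarrow> bool" where
  "kernel_extends_smoothly r h0 \<psi> \<longleftrightarrow> (\<exists>D :: nat \<Rightarrow> real \<Rightarrow> real \<Rightarrow> real \<Rightarrow> real.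
     (\<forall>h\<in>{0<..h0}. \<forall>\<tau>\<in>{0..1}. \<forall>\<sigma>\<in>{0..1}. D 0 h \<tau> \<sigma> = Pker r (\<psi> h) \<tau> \<sigma>) \<and>
     (\<forall>n. continuous_on ({0..h0} \<times> {0..1} \<times> {0..1}) (\<lambda>(h, \<tau>, \<sigma>). D n h \<tau> \<sigma>)) \<and>
     (\<forall>n. \<forall>h\<in>{0..h0}. \<forall>\<tau>\<in>{0..1}. \<forall>\<sigma>\<in>{0..1}.
        ((\<lambda>\<eta>. D n \<eta> \<tau> \<sigma>) has_real_derivative D (Suc n) h \<tau> \<sigma>) (at h within {0..h0})))"

definition Abar ::
    "nat \<Rightarrow> (nat \<Rightarrow> real \<Rightarrow> real) \<Rightarrow> real \<Rightarrow> real^'n^'n \<Rightarrow> real \<Rightarrow> real \<Rightarrow> real^'n^'n" where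
  "Abar r \<psi> h A \<tau> \<sigma> =
     integral {0..1} (\<lambda>\<xi>. Pker r \<psi> (\<xi> * \<tau>) \<sigma> *\<^sub>R mexp (((1 - \<xi>) * \<tau> * h) *\<^sub>R A))"

text \<open>
  \<open>u\<close> is a solution \<open>\<tau> \<mapsto> u(\<tau>)\<close> of the equation defining one ECr step of size \<open>h\<close> from \<open>y0\<close>;
  the result of the step is \<open>u 1\<close>.
\<close>

definition ECr_step ::
    "nat \<Rightarrow> (nat \<Rightarrow> real \<Rightarrow> real) \<Rightarrow> real \<Rightarrow> real^'n^'n \<Rightarrow> (real^'n \<Rightarrow> real^'n) \<Rightarrow> real^'n
      \<Rightarrow> (real \<Rightarrow> real^'n) \<Rightarrow> bool" where
  "ECr_step r \<psi> h A g y0 u \<longleftrightarrow>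
     continuous_on {0..1} u \<and>
     (\<forall>\<tau>\<in>{0..1}. u \<tau> = mexp ((\<tau> * h) *\<^sub>R A) *v y0 +
        (\<tau> * h) *\<^sub>R integral {0..1} (\<lambda>\<sigma>. Abar r \<psi> h A \<tau> \<sigma> *v g (u \<sigma>)))"

end

theory Submission
  imports Defs
begin

text \<open>
  Let \<open>e(\<tau>) = u(\<tau>) - y(\<tau>h)\<close>.  By the variation-of-constants formula the step solves
  \<open>u' = h (A u + \<P>\<^sub>h g(u))\<close>, so that
  \<open>e' = h (A e + \<P>\<^sub>h (g(u) - g(y)) + (\<P>\<^sub>h g(y) - g(y)))\<close>.  The function \<open>g(y(\<tau>h))\<close> is regular since
  \<open>h\<close> enters only through \<open>\<tau>h\<close>; hence \<open>e = O(h\<^sup>r\<^sup>+\<^sup>1)\<close>, and \<open>\<delta> = \<P>\<^sub>h g(u) - g(u) = O(h\<^sup>r)\<close> follows without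
  any smoothness of \<open>u\<close> in \<open>h\<close>.

  For the endpoint, let \<open>B\<close> be the Jacobian of the vector field along \<open>y\<close> and let \<open>z\<close> satisfy
  \<open>z' + B\<^sup>T z = O(t\<^sup>r)\<close>, \<open>z(0) = v\<close>.  Then the derivative of \<open>z(\<tau>h) \<bullet> e(\<tau>)\<close> is \<open>h z(\<tau>h) \<bullet> \<delta>(\<tau>)\<close> up to
  \<open>O(h\<^sup>2\<^sup>r\<^sup>+\<^sup>2)\<close>.  As \<open>\<delta>\<close> is orthogonal to \<open>Y\<^sub>h\<close>, the integral of \<open>z \<bullet> \<delta>\<close> equals that of \<open>(z - \<P>\<^sub>h z) \<bullet> \<delta>\<close>,
  which is \<open>O(h\<^sup>2\<^sup>r)\<close>.  Taking for \<open>v\<close> the unit vectors bounds \<open>e(1)\<close>.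
\<close>

section \<open>Componentwise derivatives and the bilinear matrix products\<close>

lemma has_vector_derivative_vec:
  fixes f :: "real \<Rightarrow> real^'n"
  assumes "\<And>i. ((\<lambda>t. f t $ i) has_real_derivative f' $ i) (at t within S)"
  shows "(f has_vector_derivative f') (at t within S)"
  unfolding has_vector_derivative_def
proof (subst has_derivative_componentwise_within, rule ballI)
  fix b :: "real^'n" assume "b \<in> Basis"
  then obtain i where b: "b = axis i 1" by (auto simp: Basis_vec_def)
  show "((\<lambda>x. f x \<bullet> b) has_derivative (\<lambda>x. (x *\<^sub>R f') \<bullet> b)) (at t within S)"
    using assms[of i] by (simp add: b inner_axis has_field_derivative_def mult_commute_abs)
qed

lemma has_real_derivative_vec_nth:
  fixes f :: "real \<Rightarrow> real^'n"
  assumes "(f has_vector_derivative f') (at t within S)"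
  shows "((\<lambda>t. f t $ i) has_real_derivative f' $ i) (at t within S)"
  using bounded_linear.has_vector_derivative[OF bounded_linear_vec_nth assms, of i]
  by (simp add: has_real_derivative_iff_has_vector_derivative)

text \<open>Bilinear maps between finite-dimensional spaces are bounded. This lemma and the next
  make the generic rules for sums, derivatives and continuity of bounded bilinear maps available for
  \<open>*v\<close> and \<open>**\<close>.\<close>

lemma bounded_bilinear_matrix_vector: "bounded_bilinear ((*v) :: real^'n^'m \<Rightarrow> _)"
  unfolding bilinear_conv_bounded_bilinear[symmetric] bilinear_def
  by (auto intro!: linearI simp: matrix_vector_right_distrib matrix_vector_mult_add_rdistrib
      scaleR_matrix_vector_assoc matrix_vector_mult_scaleR)

lemma bounded_bilinear_matrix_matrix:
  "bounded_bilinear ((**) :: real^'n^'m \<Rightarrow> real^'k^'n \<Rightarrow> real^'k^'m)"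
  unfolding bilinear_conv_bounded_bilinear[symmetric] bilinear_def
  by (auto intro!: linearI simp: matrix_matrix_mult_def vec_eq_iff algebra_simps sum.distrib
      sum_distrib_left)

lemmas matrix_mult_scaleR_left = bounded_bilinear.scaleR_left[OF bounded_bilinear_matrix_matrix]
  and matrix_mult_scaleR_right = bounded_bilinear.scaleR_right[OF bounded_bilinear_matrix_matrix]
  and matrix_mult_minus_left = bounded_bilinear.minus_left[OF bounded_bilinear_matrix_matrix]

subsection \<open>The matrix exponential\<close>

text \<open>The sum of all absolute entries dominates every row sum, so each further factor
  \<open>A\<close> costs at most one factor of it. The scalar exponential series of this number then
  majorizes the series of each entry.\<close>

lemma matpow_entry_bound: "\<bar>matpow A k $ i $ j\<bar> \<le> (\<Sum>i\<in>UNIV. \<Sum>j\<in>UNIV. \<bar>A $ i $ j\<bar>) ^ k"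
proof (induction k arbitrary: i)
  case 0
  show ?case by (simp add: mat_def)
next
  case (Suc k)
  let ?c = "\<Sum>i\<in>UNIV. \<Sum>j\<in>UNIV. \<bar>A $ i $ j\<bar>"
  have "\<bar>matpow A (Suc k) $ i $ j\<bar> \<le> (\<Sum>l\<in>UNIV. \<bar>A $ i $ l * matpow A k $ l $ j\<bar>)"
    by (simp add: matrix_matrix_mult_def)
  also have "\<dots> \<le> (\<Sum>l\<in>UNIV. \<bar>A $ i $ l\<bar> * ?c ^ k)"
    by (intro sum_mono) (auto simp: abs_mult intro!: mult_left_mono Suc.IH)
  also have "\<dots> = (\<Sum>l\<in>UNIV. \<bar>A $ i $ l\<bar>) * ?c ^ k"
    by (simp add: sum_distrib_right)
  also have "\<dots> \<le> ?c * ?c ^ k"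
    by (intro mult_right_mono member_le_sum[of i UNIV "\<lambda>i. \<Sum>j\<in>UNIV. \<bar>A $ i $ j\<bar>"])
      (auto intro!: sum_nonneg zero_le_power)
  finally show ?case by simp
qed

lemma summable_mexp_entry: "summable (\<lambda>k. (matpow A k $ i $ j / fact k) * t ^ k)"
proof (rule summable_comparison_test')
  let ?c = "\<Sum>i\<in>UNIV. \<Sum>j\<in>UNIV. \<bar>A $ i $ j\<bar>"
  show "summable (\<lambda>k. (?c * \<bar>t\<bar>) ^ k /\<^sub>R fact k)"
    by (rule summable_exp_generic)
  show "norm ((matpow A k $ i $ j / fact k) * t ^ k) \<le> (?c * \<bar>t\<bar>) ^ k /\<^sub>R fact k" for k
    using mult_right_mono[OF matpow_entry_bound[of A k i j], of "\<bar>t\<bar> ^ k / fact k"]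
    by (simp add: abs_mult power_abs power_mult_distrib field_simps)
qed

lemma matpow_scaleR: "matpow (t *\<^sub>R A) k = t ^ k *\<^sub>R matpow A k"
  by (induction k) (simp_all add: matrix_mult_scaleR_left matrix_mult_scaleR_right mult.commute)

text \<open>The infinite sum defining \<open>mexp\<close> carries information only once convergence
  is known. Each entry is a power series in \<open>t\<close>, and vectors converge
  entrywise.\<close>

lemma mexp_sums: "(\<lambda>k. (t ^ k / fact k) *\<^sub>R matpow A k) sums mexp (t *\<^sub>R A)"
proof -
  have "(\<lambda>k. (t ^ k / fact k) *\<^sub>R matpow A k) sums
      (\<chi> i j. \<Sum>k. (matpow A k $ i $ j / fact k) * t ^ k)"
    unfolding sums_def
  proof (intro vec_tendstoI)
    fix i j
    show "(\<lambda>n. (\<Sum>k<n. (t ^ k / fact k) *\<^sub>R matpow A k) $ i $ j)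
       \<longlonglongrightarrow> (\<chi> i j. \<Sum>k. (matpow A k $ i $ j / fact k) * t ^ k) $ i $ j"
      using summable_LIMSEQ[OF summable_mexp_entry[of A i j t]]
      by (simp add: sum_component mult.commute)
  qed
  moreover have "matpow (t *\<^sub>R A) k /\<^sub>R fact k = (t ^ k / fact k) *\<^sub>R matpow A k" for k
    by (simp add: matpow_scaleR divide_inverse mult.commute)
  ultimately show ?thesis
    unfolding mexp_def by (simp add: sums_unique[symmetric])
qed

lemma mexp_entry: "mexp (t *\<^sub>R A) $ i $ j = (\<Sum>k. (matpow A k $ i $ j / fact k) * t ^ k)"
  using sums_unique[OF bounded_linear.sums[OF bounded_linear_vec_nth
        bounded_linear.sums[OF bounded_linear_vec_nth mexp_sums[of t A], of i], of j]]
  by (simp add: mult.commute)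

lemma mexp_0: "mexp (0::real^'n^'n) = mat 1"
proof -
  have "(\<lambda>k. (0 ^ k / fact k) *\<^sub>R matpow (0::real^'n^'n) k) sums matpow 0 0"
    using sums_If_finite[of "\<lambda>k. k = 0" "\<lambda>k. matpow (0::real^'n^'n) k"]
    by (auto elim!: back_subst[of "\<lambda>f. f sums _"])
  then show ?thesis
    using sums_unique2 mexp_sums[of 0 "0::real^'n^'n"] by fastforce
qed

text \<open>\<open>A\<close> commutes with its powers, so multiplying the series by \<open>A\<close>
  from either side gives the same terms; limits are unique.\<close>

lemma mexp_commute: "mexp (t *\<^sub>R A) ** A = A ** mexp (t *\<^sub>R A)"
proof -
  have comm: "matpow A k ** A = A ** matpow A k" for k
    by (induction k) (simp_all add: matrix_mul_assoc[symmetric])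
  show ?thesis
    using bounded_linear.sums[OF bounded_bilinear.bounded_linear_left[OF bounded_bilinear_matrix_matrix, of A] mexp_sums[of t A]]
      bounded_linear.sums[OF bounded_bilinear.bounded_linear_right[OF bounded_bilinear_matrix_matrix, of A] mexp_sums[of t A]]
    by (auto simp: comm matrix_mult_scaleR_left matrix_mult_scaleR_right intro: sums_unique2)
qed

text \<open>The entries are power series and may be differentiated termwise. \<open>diffs\<close>
  shifts the coefficients by one, which splits one factor \<open>A\<close> off each power.\<close>

lemma mexp_has_vector_derivative:
  fixes A :: "real^'n^'n"
  shows "((\<lambda>t. mexp (t *\<^sub>R A)) has_vector_derivative A ** mexp (t *\<^sub>R A)) (at t within S)"
proof -
  have entry: "((\<lambda>t. mexp (t *\<^sub>R A) $ i $ j) has_real_derivative (A ** mexp (t *\<^sub>R A)) $ i $ j) (at t)" for i j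
  proof -
    have "diffs (\<lambda>k. matpow A k $ i $ j / fact k) k * t ^ k
        = (A ** ((t ^ k / fact k) *\<^sub>R matpow A k)) $ i $ j" for k
      by (simp add: diffs_def matrix_mult_scaleR_right field_simps del: of_nat_Suc)
    moreover have "(\<lambda>k. (A ** ((t ^ k / fact k) *\<^sub>R matpow A k)) $ i $ j) sums
        (A ** mexp (t *\<^sub>R A)) $ i $ j"
      by (intro bounded_linear.sums[OF bounded_linear_vec_nth] mexp_sums
          bounded_linear.sums[OF bounded_bilinear.bounded_linear_right[OF bounded_bilinear_matrix_matrix]])
    ultimately have "(\<Sum>k. diffs (\<lambda>k. matpow A k $ i $ j / fact k) k * t ^ k)
        = (A ** mexp (t *\<^sub>R A)) $ i $ j"
      by (simp add: sums_unique[symmetric])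
    then show ?thesis
      using termdiffs_strong_converges_everywhere[OF summable_mexp_entry, of A i j t]
      by (simp add: mexp_entry)
  qed
  have "((\<lambda>t. mexp (t *\<^sub>R A)) has_vector_derivative A ** mexp (t *\<^sub>R A)) (at t)"
    unfolding has_vector_derivative_def
  proof (subst has_derivative_componentwise_within, rule ballI)
    fix b :: "real^'n^'n" assume "b \<in> Basis"
    then obtain i j where b: "b = axis i (axis j 1)" by (auto simp: Basis_vec_def)
    show "((\<lambda>x. mexp (x *\<^sub>R A) \<bullet> b) has_derivative
        (\<lambda>x. (x *\<^sub>R (A ** mexp (t *\<^sub>R A))) \<bullet> b)) (at t)"
      using entry[of i j]
      by (simp add: b inner_axis has_field_derivative_def mult_commute_abs)
  qed
  then show ?thesis by (rule has_vector_derivative_at_within)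
qed

text \<open>The product is constant in \<open>s\<close>, because its derivative vanishes when
  \<open>A\<close> commutes with the exponential; compare with \<open>s = 0\<close>. Later this
  serves as the functional equation and, with \<open>a = 0\<close>, as invertibility.\<close>

lemma mexp_diff_mult: "mexp ((a - s) *\<^sub>R A) ** mexp (s *\<^sub>R A) = mexp (a *\<^sub>R A)"
proof -
  let ?G = "\<lambda>s. mexp ((a - s) *\<^sub>R A) ** mexp (s *\<^sub>R A)"
  have "(?G has_vector_derivative 0) (at s)" for s
  proof -
    have 1: "((\<lambda>s. mexp ((a - s) *\<^sub>R A)) has_vector_derivative
        (- 1) *\<^sub>R (A ** mexp ((a - s) *\<^sub>R A))) (at s)"
    proof -
      have "((\<lambda>s. a - s) has_vector_derivative - 1) (at s)"
        by (auto intro!: derivative_eq_intros)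
      from vector_diff_chain_at[OF this mexp_has_vector_derivative] show ?thesis
        by (simp add: o_def)
    qed
    show ?thesis
      using bounded_bilinear.has_vector_derivative[OF bounded_bilinear_matrix_matrix 1
          mexp_has_vector_derivative[of A s UNIV]]
      by (simp add: matrix_mul_assoc mexp_commute matrix_mult_scaleR_left
          matrix_mult_minus_left matrix_mult_scaleR_right)
  qed
  then obtain c where "\<And>s. ?G s = c"
    using has_vector_derivative_zero_constant[of UNIV ?G] by auto
  from this[of s] this[of 0] show ?thesis by (simp add: mexp_0)
qed

subsection \<open>Smooth functions\<close>

lemma Ck_on_const: "Ck_on k S (\<lambda>_. c)"
proof (induction k arbitrary: c)
  case (Suc k)
  then show ?case by (simp add: frechet_derivative_at[OF has_derivative_const, symmetric])
qed simp

lemma Ck_on_bounded_linear: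
  assumes "bounded_linear f" shows "Ck_on k S f"
proof (cases k)
  case 0
  then show ?thesis using assms by (simp add: linear_continuous_on)
next
  case (Suc m)
  have "(f has_derivative f) (at x)" for x
    using assms by (rule bounded_linear_imp_has_derivative)
  then have "frechet_derivative f (at x) = f" for x
    by (simp add: frechet_derivative_at[symmetric])
  then show ?thesis
    using Suc assms by (auto simp: Ck_on_const bounded_linear_imp_differentiable)
qed

lemma Ck_on_add: "Ck_on k UNIV f \<Longrightarrow> Ck_on k UNIV g \<Longrightarrow> Ck_on k UNIV (\<lambda>x. f x + g x)"
proof (induction k arbitrary: f g)
  case (Suc k)
  then have "\<And>x. f differentiable at x" "\<And>x. g differentiable at x" by auto
  then have "frechet_derivative (\<lambda>x. f x + g x) (at x) =
      (\<lambda>v. frechet_derivative f (at x) v + frechet_derivative g (at x) v)" for x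
    by (intro frechet_derivative_at[symmetric] has_derivative_add)
      (simp_all add: frechet_derivative_works[symmetric])
  with Suc show ?case by auto
qed (simp add: continuous_on_add)

lemma smooth_on_add: "smooth_on UNIV f \<Longrightarrow> smooth_on UNIV g \<Longrightarrow> smooth_on UNIV (\<lambda>x. f x + g x)"
  by (simp add: smooth_on_def Ck_on_add)

lemma smooth_on_frechet_derivative:
  "smooth_on S f \<Longrightarrow> smooth_on S (\<lambda>x. frechet_derivative f (at x) v)"
  unfolding smooth_on_def
proof
  fix k assume "\<forall>k. Ck_on k S f"
  then have "Ck_on (Suc k) S f" ..
  then show "Ck_on k S (\<lambda>x. frechet_derivative f (at x) v)" by simp
qed

lemma smooth_on_has_derivative:
  "smooth_on S f \<Longrightarrow> x \<in> S \<Longrightarrow> (f has_derivative frechet_derivative f (at x)) (at x)"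
  unfolding smooth_on_def frechet_derivative_works[symmetric] by (auto dest: spec[of _ "Suc 0"])

lemma smooth_on_continuous_on: "smooth_on S f \<Longrightarrow> continuous_on S f"
  unfolding smooth_on_def by (auto dest: spec[of _ 0])

text \<open>\<open>Ck_on\<close> controls derivatives only in a fixed direction. Expanding in unit
  vectors reduces directions that vary with the point to finitely many fixed ones.\<close>

lemma has_derivative_axis_sum:
  fixes f :: "real^'n \<Rightarrow> real"
  assumes "(f has_derivative f') F"
  shows "f' v = (\<Sum>j\<in>UNIV. v $ j * f' (axis j 1))"
proof -
  have "linear f'" using assms has_derivative_linear by blast
  have "f' v = f' (\<Sum>j\<in>UNIV. v $ j *\<^sub>R axis j 1)"
    using basis_expansion[of v] by (simp add: scalar_mult_eq_scaleR)
  also have "\<dots> = (\<Sum>j\<in>UNIV. v $ j * f' (axis j 1))"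
    by (simp add: linear_sum[OF \<open>linear f'\<close>] linear_scale[OF \<open>linear f'\<close>])
  finally show ?thesis .
qed

text \<open>Counterpart of \<open>Ck_on\<close> for a compact interval, with one-sided derivatives
  at the ends, since the exact solution is given only on \<open>{0..h0}\<close>. The derivative is
  existentially quantified, so that no derivative operator has to be evaluated at an
  endpoint.\<close>

primrec Ck_Icc :: "real \<Rightarrow> nat \<Rightarrow> (real \<Rightarrow> real) \<Rightarrow> bool" where
  "Ck_Icc b 0 f \<longleftrightarrow> continuous_on {0..b} f"
| "Ck_Icc b (Suc k) f \<longleftrightarrow>
     (\<exists>f'. (\<forall>t\<in>{0..b}. (f has_real_derivative f' t) (at t within {0..b})) \<and> Ck_Icc b k f')"

lemma Ck_Icc_SucD: "Ck_Icc b (Suc k) f \<Longrightarrow> Ck_Icc b k f"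
proof (induction k arbitrary: f)
  case 0
  then obtain f' where "\<forall>t\<in>{0..b}. (f has_real_derivative f' t) (at t within {0..b})"
    by auto
  then show ?case using DERIV_continuous_on[of "{0..b}" f f'] by simp
next
  case (Suc k)
  then obtain f' where "\<forall>t\<in>{0..b}. (f has_real_derivative f' t) (at t within {0..b})"
    "Ck_Icc b (Suc k) f'" by (auto simp del: Ck_Icc.simps(1) simp: Ck_Icc.simps(2)[of b "Suc k" f])
  with Suc.IH[of f'] show ?case by auto
qed

lemma Ck_Icc_continuous_on: "Ck_Icc b k f \<Longrightarrow> continuous_on {0..b} f"
  by (induction k) (simp, metis Ck_Icc_SucD)

lemma Ck_Icc_const: "Ck_Icc b k (\<lambda>_. c)"
  by (induction k arbitrary: c) (auto intro!: exI[of _ "\<lambda>_. 0"])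

lemma Ck_Icc_add: "Ck_Icc b k f \<Longrightarrow> Ck_Icc b k g \<Longrightarrow> Ck_Icc b k (\<lambda>t. f t + g t)"
proof (induction k arbitrary: f g)
  case (Suc k)
  then obtain f' g' where
    "\<forall>t\<in>{0..b}. (f has_real_derivative f' t) (at t within {0..b})" "Ck_Icc b k f'"
    "\<forall>t\<in>{0..b}. (g has_real_derivative g' t) (at t within {0..b})" "Ck_Icc b k g'" by auto
  then show ?case
    using Suc.IH by (auto intro!: exI[of _ "\<lambda>t. f' t + g' t"] DERIV_add)
qed (simp add: continuous_on_add)

lemma Ck_Icc_mult: "Ck_Icc b k f \<Longrightarrow> Ck_Icc b k g \<Longrightarrow> Ck_Icc b k (\<lambda>t. f t * g t)"
proof (induction k arbitrary: f g)
  case (Suc k)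
  then obtain f' g' where D:
    "\<forall>t\<in>{0..b}. (f has_real_derivative f' t) (at t within {0..b})" "Ck_Icc b k f'"
    "\<forall>t\<in>{0..b}. (g has_real_derivative g' t) (at t within {0..b})" "Ck_Icc b k g'" by auto
  have "Ck_Icc b k (\<lambda>t. f' t * g t + g' t * f t)"
    by (intro Ck_Icc_add Suc.IH D Ck_Icc_SucD[OF Suc.prems(1)] Ck_Icc_SucD[OF Suc.prems(2)])
  then show ?case
    using D by (auto intro!: exI[of _ "\<lambda>t. f' t * g t + g' t * f t"] DERIV_mult)
qed (simp add: continuous_on_mult)

lemma Ck_Icc_sum: "(\<And>i. i \<in> I \<Longrightarrow> Ck_Icc b k (f i)) \<Longrightarrow> Ck_Icc b k (\<lambda>t. \<Sum>i\<in>I. f i t)"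
  by (induction I rule: infinite_finite_induct) (auto simp: Ck_Icc_const intro!: Ck_Icc_add)

text \<open>Bootstrapping: by the chain rule the derivative of \<open>\<phi> (y t)\<close> is a sum
  of products of smooth functions evaluated along \<open>y\<close>. The induction therefore runs
  over all smooth \<open>\<phi>\<close> at once, and the differential equation is all that has to be
  known about \<open>y\<close>.\<close>

lemma Ck_Icc_along_solution:
  fixes y :: "real \<Rightarrow> real^'n" and \<phi> :: "real^'n \<Rightarrow> real"
  assumes F: "\<And>i. smooth_on UNIV (\<lambda>x. F x $ i)"
    and y: "\<And>t. t \<in> {0..b} \<Longrightarrow> (y has_vector_derivative F (y t)) (at t within {0..b})"
    and "smooth_on UNIV \<phi>"
  shows "Ck_Icc b k (\<lambda>t. \<phi> (y t))"
  using \<open>smooth_on UNIV \<phi>\<close>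
proof (induction k arbitrary: \<phi>)
  case 0
  have "continuous_on {0..b} y"
    by (rule continuous_on_vector_derivative[OF y])
  then show ?case
    using continuous_on_compose2[OF smooth_on_continuous_on[OF 0], of "{0..b}" y] by simp
next
  case (Suc k)
  let ?D = "\<lambda>t. \<Sum>j\<in>UNIV. F (y t) $ j * frechet_derivative \<phi> (at (y t)) (axis j 1)"
  have "((\<lambda>t. \<phi> (y t)) has_real_derivative ?D t) (at t within {0..b})" if "t \<in> {0..b}" for t
  proof -
    have d: "(\<phi> has_derivative frechet_derivative \<phi> (at (y t))) (at (y t))"
      using Suc.prems by (simp add: smooth_on_has_derivative)
    then have "((\<phi> \<circ> y) has_vector_derivative frechet_derivative \<phi> (at (y t)) (F (y t)))
        (at t within {0..b})"
      by (rule vector_derivative_diff_chain_within[OF y[OF that] has_derivative_at_withinI])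
    then show ?thesis
      unfolding has_derivative_axis_sum[OF d, of "F (y t)"]
      by (simp add: has_real_derivative_iff_has_vector_derivative o_def)
  qed
  moreover have "Ck_Icc b k ?D"
    by (rule Ck_Icc_sum, rule Ck_Icc_mult)
      (rule Suc.IH[OF F] Suc.IH[OF smooth_on_frechet_derivative[OF Suc.prems]])+
  ultimately show ?case
    unfolding Ck_Icc.simps by (intro exI[of _ ?D] conjI ballI)
qed

text \<open>Turns the nested existential quantifiers of \<open>Ck_Icc\<close> into one sequence of
  derivatives; the induction step prepends \<open>f\<close> to the sequence of
  \<open>f'\<close>.\<close>

lemma Ck_Icc_derivatives:
  assumes "Ck_Icc b k f"
  obtains D where "D 0 = f"
    "\<And>n t. n < k \<Longrightarrow> t \<in> {0..b} \<Longrightarrow> (D n has_real_derivative D (Suc n) t) (at t within {0..b})"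
    "continuous_on {0..b} (D k)"
proof -
  have "\<exists>D. D 0 = f \<and>
      (\<forall>n t. n < k \<longrightarrow> t \<in> {0..b} \<longrightarrow> (D n has_real_derivative D (Suc n) t) (at t within {0..b})) \<and>
      continuous_on {0..b} (D k)"
    using assms
  proof (induction k arbitrary: f)
    case 0
    then show ?case by (auto intro: exI[of _ "\<lambda>_. f"])
  next
    case (Suc k)
    then obtain f' where f': "\<forall>t\<in>{0..b}. (f has_real_derivative f' t) (at t within {0..b})"
      "Ck_Icc b k f'" by auto
    from Suc.IH[OF f'(2)] obtain D where "D 0 = f'"
      "\<forall>n t. n < k \<longrightarrow> t \<in> {0..b} \<longrightarrow> (D n has_real_derivative D (Suc n) t) (at t within {0..b})"
      "continuous_on {0..b} (D k)" by blast
    with f'(1) show ?case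
      by (intro exI[of _ "case_nat f D"] conjI allI impI)
        (simp_all add: less_Suc_eq_0_disj split: nat.split, auto)
  qed
  then show ?thesis using that by blast
qed

section \<open>Taylor expansion and regularity of rescaled functions\<close>

lemma vector_derivative_bound_from_0:
  fixes f :: "real \<Rightarrow> 'a::real_normed_vector"
  assumes "\<And>s. s \<in> {0..b} \<Longrightarrow> (f has_vector_derivative f' s) (at s within {0..b})"
    and "\<And>s. s \<in> {0..t} \<Longrightarrow> norm (f' s) \<le> B" and "t \<in> {0..b}"
  shows "norm (f t - f 0) \<le> B * t"
proof -
  have "norm (f t - f 0) \<le> B * norm (t - 0)"
  proof (rule differentiable_bound[where S = "{0..t}" and f' = "\<lambda>s x. x *\<^sub>R f' s"])
    fix s assume s: "s \<in> {0..t}"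
    show "(f has_derivative (\<lambda>x. x *\<^sub>R f' s)) (at s within {0..t})"
      using assms(1)[of s] s assms(3) unfolding has_vector_derivative_def
      by (auto intro: has_derivative_subset)
    show "onorm (\<lambda>x. x *\<^sub>R f' s) \<le> B"
      by (rule onorm_le) (use assms(2)[OF s] in \<open>simp add: mult.commute[of B] mult_left_mono\<close>)
  qed (use assms in auto)
  then show ?thesis using assms(3) by simp
qed

text \<open>The derivative of the remainder is the remainder of one order less for
  \<open>D (Suc 0)\<close>. The induction hypothesis bounds it by \<open>C * t ^ k\<close> on
  \<open>{0..t}\<close>, and the mean value inequality adds a factor \<open>t\<close>.\<close>

lemma taylor_remainder_bound:
  fixes D :: "nat \<Rightarrow> real \<Rightarrow> real"
  assumes "\<And>n t. n < k \<Longrightarrow> t \<in> {0..b} \<Longrightarrow> (D n has_real_derivative D (Suc n) t) (at t within {0..b})"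
    and "\<And>t. t \<in> {0..b} \<Longrightarrow> \<bar>D k t\<bar> \<le> C" and "t \<in> {0..b}"
  shows "\<bar>D 0 t - (\<Sum>n<k. t ^ n * (D n 0 / fact n))\<bar> \<le> C * t ^ k"
  using assms
proof (induction k arbitrary: D t)
  case (Suc k)
  let ?R = "\<lambda>s. D 0 s - (D 0 0 + (\<Sum>n<k. s ^ Suc n * (D (Suc n) 0 / fact (Suc n))))"
  let ?R' = "\<lambda>s. D (Suc 0) s - (\<Sum>n<k. s ^ n * (D (Suc n) 0 / fact n))"
  have C: "0 \<le> C" using Suc.prems(2,3) abs_ge_zero order_trans by blast
  have "(?R has_vector_derivative ?R' s) (at s within {0..b})" if "s \<in> {0..b}" for s
    unfolding has_real_derivative_iff_has_vector_derivative[symmetric]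
    by (rule derivative_eq_intros Suc.prems(1) that refl zero_less_Suc)+
      (simp add: field_simps del: of_nat_Suc)
  moreover have "norm (?R' s) \<le> C * t ^ k" if "s \<in> {0..t}" for s
  proof -
    have "\<bar>?R' s\<bar> \<le> C * s ^ k"
      by (rule Suc.IH[of "\<lambda>n. D (Suc n)"]) (use Suc.prems that in auto)
    also have "\<dots> \<le> C * t ^ k"
      using that C by (intro mult_left_mono power_mono) auto
    finally show ?thesis by simp
  qed
  ultimately have "norm (?R t - ?R 0) \<le> C * t ^ k * t"
    by (rule vector_derivative_bound_from_0[where f = ?R and f' = ?R']) (use Suc.prems in auto)
  then show ?case
    by (simp add: sum.lessThan_Suc_shift mult_ac del: fact_Suc sum.lessThan_Suc)
qed simp

lemma eventually_at_right_0_le: "0 < b \<Longrightarrow> \<forall>\<^sub>F h in at_right (0::real). h \<in> {0<..b}"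
  using eventually_at_right_real[of 0 b] by (auto elim: eventually_mono)

text \<open>Each differentiation in \<open>h\<close> brings out a factor \<open>\<tau>\<close>, so
  at \<open>h = 0\<close> the \<open>n\<close>-th derivative is a constant multiple of
  \<open>\<tau> ^ n\<close>, a polynomial of degree at most \<open>n\<close>. The remainder is
  Taylor's at the point \<open>\<tau> * h\<close>, which is at most \<open>h\<close>.\<close>

lemma regular_scaled:
  fixes z :: "real \<Rightarrow> real^'n"
  assumes "0 < b" and z: "\<And>i. Ck_Icc b r (\<lambda>t. z t $ i)"
  shows "regular r (\<lambda>h \<tau>. z (\<tau> * h))"
proof -
  have "\<forall>i. \<exists>D. D 0 = (\<lambda>t. z t $ i) \<and>
      (\<forall>n t. n < r \<longrightarrow> t \<in> {0..b} \<longrightarrow> (D n has_real_derivative D (Suc n) t) (at t within {0..b})) \<and>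
      continuous_on {0..b} (D r)"
    (is "\<forall>i. \<exists>D. ?P i D")
  proof
    fix i
    show "\<exists>D. ?P i D" by (rule Ck_Icc_derivatives[OF z[of i]]) blast
  qed
  from choice[OF this] obtain D where D0: "\<And>i. D i 0 = (\<lambda>t. z t $ i)"
    and D: "\<And>i n t. n < r \<Longrightarrow> t \<in> {0..b} \<Longrightarrow>
      (D i n has_real_derivative D i (Suc n) t) (at t within {0..b})"
    and Dr: "\<And>i. continuous_on {0..b} (D i r)" by blast
  have "\<forall>i. \<exists>C. \<forall>t\<in>{0..b}. \<bar>D i r t\<bar> \<le> C"
    using compact_imp_bounded[OF compact_continuous_image[OF Dr compact_Icc]]
    by (auto simp: bounded_iff)
  from choice[OF this] obtain C where C: "\<And>i t. t \<in> {0..b} \<Longrightarrow> \<bar>D i r t\<bar> \<le> C i" by blast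
  have in_b: "\<tau> * h \<in> {0..b}" if "\<tau> \<in> {0..1}" "h \<in> {0..b}" for \<tau> h
    using that mult_mono[of \<tau> 1 h b] by auto
  define W :: "nat \<Rightarrow> real \<Rightarrow> real \<Rightarrow> real^'n" where
    "W = (\<lambda>n h \<tau>. \<chi> i. \<tau> ^ n * D i n (\<tau> * h))"
  have cont: "continuous_on {0..1} (\<lambda>\<tau>. z (\<tau> * h))" if "h \<in> {0..b}" for h
  proof -
    have "continuous_on {0..b} z"
      using continuous_on_vec_lambda[of "{0..b}" "\<lambda>i t. z t $ i"] Ck_Icc_continuous_on[OF z]
      by simp
    then show ?thesis
      by (rule continuous_on_compose2) (auto intro!: continuous_intros in_b that)
  qed
  have deriv: "((\<lambda>\<eta>. W n \<eta> \<tau>) has_vector_derivative W (Suc n) h \<tau>) (at h within {0..b})"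
    if "Suc n < r" "h \<in> {0..b}" "\<tau> \<in> {0..1}" for n h \<tau>
  proof (rule has_vector_derivative_vec)
    fix i
    have "((\<lambda>\<eta>. D i n (\<tau> * \<eta>)) has_real_derivative D i (Suc n) (\<tau> * h) * \<tau>) (at h within {0..b})"
    proof (rule DERIV_image_chain[where g = "\<lambda>\<eta>. \<tau> * \<eta>" and f = "D i n", unfolded o_def])
      show "((*) \<tau> has_real_derivative \<tau>) (at h within {0..b})"
        by (auto intro!: derivative_eq_intros)
      show "(D i n has_real_derivative D i (Suc n) (\<tau> * h)) (at (\<tau> * h) within (*) \<tau> ` {0..b})"
        by (rule DERIV_subset[OF D]) (use that in_b in auto)
    qed
    then show "((\<lambda>\<eta>. W n \<eta> \<tau> $ i) has_real_derivative W (Suc n) h \<tau> $ i) (at h within {0..b})"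
      unfolding W_def by (auto intro!: derivative_eq_intros)
  qed
  have poly: "\<exists>p::real poly. degree p \<le> n \<and> (\<forall>\<tau>\<in>{0..1}. (W n 0 \<tau> /\<^sub>R fact n) $ i = poly p \<tau>)" for n i
    by (rule exI[of _ "monom (D i n 0 / fact n) n"])
      (simp add: W_def poly_monom degree_monom_le divide_inverse mult_ac)
  have bigo: "unif_bigo {0..1} (\<lambda>h \<tau>. z (\<tau> * h) - (\<Sum>n<r. h ^ n *\<^sub>R (W n 0 \<tau> /\<^sub>R fact n))) r"
    unfolding unif_bigo_def
  proof (intro exI[of _ "\<Sum>i\<in>UNIV. C i"], rule eventually_mono[OF eventually_at_right_0_le[OF \<open>0 < b\<close>]], rule ballI)
    fix h \<tau> :: real assume h: "h \<in> {0<..b}" and \<tau>: "\<tau> \<in> {0..1}"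
    let ?e = "z (\<tau> * h) - (\<Sum>n<r. h ^ n *\<^sub>R (W n 0 \<tau> /\<^sub>R fact n))"
    have "\<bar>?e $ i\<bar> \<le> C i * h ^ r" for i
    proof -
      have "?e $ i = D i 0 (\<tau> * h) - (\<Sum>n<r. (\<tau> * h) ^ n * (D i n 0 / fact n))"
        by (simp add: D0 W_def power_mult_distrib divide_inverse mult_ac)
      also have "\<bar>\<dots>\<bar> \<le> C i * (\<tau> * h) ^ r"
        by (rule taylor_remainder_bound[OF D C]) (use h \<tau> in_b in auto)
      also have "\<dots> \<le> C i * h ^ r"
        using h \<tau> order_trans[OF abs_ge_zero C[of 0 i]] \<open>0 < b\<close>
        by (intro mult_left_mono power_mono) (auto simp: mult_left_le_one_le)
      finally show ?thesis .
    qed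
    then have "(\<Sum>i\<in>UNIV. \<bar>?e $ i\<bar>) \<le> (\<Sum>i\<in>UNIV. C i * h ^ r)" by (intro sum_mono)
    then show "norm ?e \<le> (\<Sum>i\<in>UNIV. C i) * h ^ r"
      using norm_le_l1_cart[of ?e] by (simp add: sum_distrib_right)
  qed
  show ?thesis
    unfolding regular_def
    by (rule exI[of _ b], intro conjI \<open>0 < b\<close> exI[of _ W])
      (intro ballI allI impI cont deriv poly bigo; simp add: W_def D0 vec_eq_iff)+
qed

section \<open>Lipschitz and linearization bounds on compact convex sets\<close>

lemma sum_mult_abs_le_norm:
  fixes v :: "real^'n"
  assumes "\<And>j. \<bar>a j\<bar> \<le> C j"
  shows "\<bar>\<Sum>j\<in>UNIV. v $ j * a j\<bar> \<le> (\<Sum>j\<in>UNIV. C j) * norm v"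
proof -
  have "\<bar>\<Sum>j\<in>UNIV. v $ j * a j\<bar> \<le> (\<Sum>j\<in>UNIV. \<bar>v $ j * a j\<bar>)" by (rule sum_abs)
  also have "\<dots> \<le> (\<Sum>j\<in>UNIV. norm v * C j)"
    using assms by (intro sum_mono) (auto simp: abs_mult intro!: mult_mono component_le_norm_cart)
  finally show ?thesis by (simp add: sum_distrib_left mult.commute[of _ "norm v"])
qed

text \<open>Continuity bounds the partial derivatives on the compact set, their bounds add up to a
  bound for the operator norm, and convexity admits the mean value inequality.\<close>

lemma smooth_Lipschitz:
  fixes \<phi> :: "real^'n \<Rightarrow> real"
  assumes "smooth_on UNIV \<phi>" "compact K" "convex K"
  obtains L where "0 \<le> L" "\<And>x z. x \<in> K \<Longrightarrow> z \<in> K \<Longrightarrow> \<bar>\<phi> x - \<phi> z\<bar> \<le> L * norm (x - z)"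
proof -
  have "\<forall>j. \<exists>C\<ge>0. \<forall>x\<in>K. \<bar>frechet_derivative \<phi> (at x) (axis j 1)\<bar> \<le> C"
  proof
    fix j
    have "continuous_on K (\<lambda>x. frechet_derivative \<phi> (at x) (axis j 1))"
      using smooth_on_continuous_on[OF smooth_on_frechet_derivative[OF assms(1)]]
      by (rule continuous_on_subset) simp
    then have "bounded ((\<lambda>x. frechet_derivative \<phi> (at x) (axis j 1)) ` K)"
      by (intro compact_imp_bounded compact_continuous_image assms)
    then obtain C where "0 < C" "\<forall>x\<in>K. \<bar>frechet_derivative \<phi> (at x) (axis j 1)\<bar> \<le> C"
      unfolding bounded_pos by auto
    then show "\<exists>C\<ge>0. \<forall>x\<in>K. \<bar>frechet_derivative \<phi> (at x) (axis j 1)\<bar> \<le> C"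
      by (intro exI[of _ C]) simp
  qed
  from choice[OF this] obtain C where C0: "\<And>j. 0 \<le> C j"
    and C: "\<And>j x. x \<in> K \<Longrightarrow> \<bar>frechet_derivative \<phi> (at x) (axis j 1)\<bar> \<le> C j" by blast
  have der: "(\<phi> has_derivative frechet_derivative \<phi> (at x)) (at x)" for x
    using assms(1) by (simp add: smooth_on_has_derivative)
  have "norm (\<phi> x - \<phi> z) \<le> (\<Sum>j\<in>UNIV. C j) * norm (x - z)" if "x \<in> K" "z \<in> K" for x z
  proof (rule differentiable_bound[OF assms(3) has_derivative_at_withinI[OF der] _ that])
    fix w assume w: "w \<in> K"
    show "onorm (frechet_derivative \<phi> (at w)) \<le> (\<Sum>j\<in>UNIV. C j)"
    proof (rule onorm_le)
      fix v
      show "norm (frechet_derivative \<phi> (at w) v) \<le> (\<Sum>j\<in>UNIV. C j) * norm v"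
        using sum_mult_abs_le_norm[of "\<lambda>j. frechet_derivative \<phi> (at w) (axis j 1)" C v] C[OF w]
        by (simp add: has_derivative_axis_sum[OF der, of w v])
    qed
  qed
  moreover have "0 \<le> (\<Sum>j\<in>UNIV. C j)" by (intro sum_nonneg C0)
  ultimately show ?thesis using that by auto
qed

text \<open>Mean value inequality for \<open>\<phi>\<close> minus its linear part at
  \<open>z\<close>: the derivative of this difference is the change of the derivative of
  \<open>\<phi>\<close>, and the partial derivatives are Lipschitz on \<open>K\<close> by the
  previous lemma.\<close>

lemma smooth_linearization:
  fixes \<phi> :: "real^'n \<Rightarrow> real"
  assumes "smooth_on UNIV \<phi>" "compact K" "convex K"
  obtains L where "0 \<le> L" "\<And>x z. x \<in> K \<Longrightarrow> z \<in> K \<Longrightarrow>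
    \<bar>\<phi> x - \<phi> z - frechet_derivative \<phi> (at z) (x - z)\<bar> \<le> L * (norm (x - z))\<^sup>2"
proof -
  let ?D = "\<lambda>x. frechet_derivative \<phi> (at x)"
  have "\<forall>j. \<exists>L\<ge>0. \<forall>x\<in>K. \<forall>z\<in>K. \<bar>?D x (axis j 1) - ?D z (axis j 1)\<bar> \<le> L * norm (x - z)"
  proof
    fix j
    show "\<exists>L\<ge>0. \<forall>x\<in>K. \<forall>z\<in>K. \<bar>?D x (axis j 1) - ?D z (axis j 1)\<bar> \<le> L * norm (x - z)"
      by (rule smooth_Lipschitz[OF smooth_on_frechet_derivative[OF assms(1)] assms(2,3), of "axis j 1"]) blast
  qed
  from choice[OF this] obtain L where L0: "\<And>j. 0 \<le> L j"
    and L: "\<And>j x z. x \<in> K \<Longrightarrow> z \<in> K \<Longrightarrow> \<bar>?D x (axis j 1) - ?D z (axis j 1)\<bar> \<le> L j * norm (x - z)"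
    by blast
  have der: "(\<phi> has_derivative ?D x) (at x)" for x
    using assms(1) by (simp add: smooth_on_has_derivative)
  have lin: "bounded_linear (?D x)" for x
    using der by (rule has_derivative_bounded_linear)
  have "\<bar>\<phi> x - \<phi> z - ?D z (x - z)\<bar> \<le> (\<Sum>j\<in>UNIV. L j) * (norm (x - z))\<^sup>2"
    if "x \<in> K" "z \<in> K" for x z
  proof -
    have sub: "closed_segment z x \<subseteq> K"
      using that assms(3) by (simp add: closed_segment_subset)
    \<comment> \<open>The segment replaces \<open>K\<close> here because on it
      \<open>norm (w - z)\<close> does not exceed \<open>norm (x - z)\<close>, which supplies the
      second factor.\<close>
    have "norm ((\<phi> x - ?D z x) - (\<phi> z - ?D z z)) \<le> (\<Sum>j\<in>UNIV. L j * norm (x - z)) * norm (x - z)"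
    proof (rule differentiable_bound[where S = "closed_segment z x" and f' = "\<lambda>w v. ?D w v - ?D z v"])
      fix w assume w: "w \<in> closed_segment z x"
      show "((\<lambda>w. \<phi> w - ?D z w) has_derivative (\<lambda>v. ?D w v - ?D z v)) (at w within closed_segment z x)"
        by (intro has_derivative_diff has_derivative_at_withinI[OF der]
            bounded_linear_imp_has_derivative lin)
      show "onorm (\<lambda>v. ?D w v - ?D z v) \<le> (\<Sum>j\<in>UNIV. L j * norm (x - z))"
      proof (rule onorm_le)
        fix v
        have "?D w v - ?D z v = (\<Sum>j\<in>UNIV. v $ j * (?D w (axis j 1) - ?D z (axis j 1)))"
          using has_derivative_axis_sum[OF der, of w v] has_derivative_axis_sum[OF der, of z v]
          by (simp add: right_diff_distrib sum_subtractf)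
        also have "\<bar>\<dots>\<bar> \<le> (\<Sum>j\<in>UNIV. L j * norm (x - z)) * norm v"
        proof (rule sum_mult_abs_le_norm)
          fix j
          have "\<bar>?D w (axis j 1) - ?D z (axis j 1)\<bar> \<le> L j * norm (w - z)"
            using w sub that by (intro L) auto
          also have "\<dots> \<le> L j * norm (x - z)"
            using segment_bound1[OF w] L0 by (intro mult_left_mono) (auto simp: norm_minus_commute)
          finally show "\<bar>?D w (axis j 1) - ?D z (axis j 1)\<bar> \<le> L j * norm (x - z)" .
        qed
        finally show "norm (?D w v - ?D z v) \<le> (\<Sum>j\<in>UNIV. L j * norm (x - z)) * norm v" by simp
      qed
    qed auto
    then show ?thesis
      by (simp add: linear_diff[OF bounded_linear.linear[OF lin]] sum_distrib_right[symmetric]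
          power2_eq_square algebra_simps)
  qed
  moreover have "0 \<le> (\<Sum>j\<in>UNIV. L j)" by (intro sum_nonneg L0)
  ultimately show ?thesis using that by blast
qed

subsection \<open>The adjoint equation\<close>

text \<open>Picard iteration gains one power of \<open>t\<close> in the residual of \<open>z' = - B\<^sup>T z\<close> at each step.\<close>

lemma adjoint_approximation:
  fixes B :: "'n::finite \<Rightarrow> 'n \<Rightarrow> real \<Rightarrow> real" and v :: "real^'n"
  assumes B: "\<And>i j. Ck_Icc b k (B i j)"
  obtains z z' C where "z 0 = v" "\<And>i. Ck_Icc b k (\<lambda>t. z t $ i)"
    "\<And>t. t \<in> {0..b} \<Longrightarrow> (z has_vector_derivative z' t) (at t within {0..b})"
    "\<And>t j. t \<in> {0..b} \<Longrightarrow> \<bar>z' t $ j + (\<Sum>i\<in>UNIV. z t $ i * B i j t)\<bar> \<le> C * t ^ N"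
proof -
  have "\<forall>i j. \<exists>M. \<forall>t\<in>{0..b}. \<bar>B i j t\<bar> \<le> M"
    using compact_imp_bounded[OF compact_continuous_image[OF Ck_Icc_continuous_on[OF B] compact_Icc]]
    by (auto simp: bounded_iff)
  \<comment> \<open>Indexing the entries by pairs lets a single choice collect their bounds; the sum
    of these serves all entries at once.\<close>
  then have "\<forall>p. \<exists>M. \<forall>t\<in>{0..b}. \<bar>B (fst p) (snd p) t\<bar> \<le> M" by simp
  from choice[OF this] obtain M' where M': "\<And>p t. t \<in> {0..b} \<Longrightarrow> \<bar>B (fst p) (snd p) t\<bar> \<le> M' p"
    by blast
  define M where "M = (\<Sum>p\<in>UNIV. \<bar>M' p\<bar>)"
  have M: "\<bar>B i j t\<bar> \<le> M" if "t \<in> {0..b}" for i j t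
    using M'[OF that, of "(i, j)"] member_le_sum[of "(i, j)" UNIV "\<lambda>p. \<bar>M' p\<bar>"]
    by (simp add: M_def)
  have "\<exists>z z' C. z 0 = v \<and> (\<forall>i. Ck_Icc b k (\<lambda>t. z t $ i)) \<and>
    (\<forall>t\<in>{0..b}. (z has_vector_derivative z' t) (at t within {0..b})) \<and>
    (\<forall>t\<in>{0..b}. \<forall>j. \<bar>z' t $ j + (\<Sum>i\<in>UNIV. z t $ i * B i j t)\<bar> \<le> C * t ^ N)"
  proof (induction N)
    case 0
    have "\<bar>\<Sum>i\<in>UNIV. v $ i * B i j t\<bar> \<le> (\<Sum>i\<in>(UNIV::'n set). M) * norm v" if "t \<in> {0..b}" for t j
      using M[OF that] by (intro sum_mult_abs_le_norm)
    then show ?case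
      by (intro exI[of _ "\<lambda>_. v"] exI[of _ "\<lambda>_. 0"] exI[of _ "(\<Sum>i\<in>(UNIV::'n set). M) * norm v"])
        (simp add: Ck_Icc_const)
  next
    case (Suc N)
    then obtain z z' C where z0: "z 0 = v" and Ck: "\<And>i. Ck_Icc b k (\<lambda>t. z t $ i)"
      and der: "\<And>t. t \<in> {0..b} \<Longrightarrow> (z has_vector_derivative z' t) (at t within {0..b})"
      and res: "\<And>t j. t \<in> {0..b} \<Longrightarrow> \<bar>z' t $ j + (\<Sum>i\<in>UNIV. z t $ i * B i j t)\<bar> \<le> C * t ^ N"
      by blast
    define p where "p = (\<lambda>j t. - (\<Sum>i\<in>UNIV. z t $ i * B i j t))"
    have p: "Ck_Icc b k (p j)" for j
    proof -
      have "Ck_Icc b k (\<lambda>t. (- 1) * (\<Sum>i\<in>UNIV. z t $ i * B i j t))"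
        by (intro Ck_Icc_mult Ck_Icc_sum Ck B Ck_Icc_const)
      then show ?thesis by (simp add: p_def)
    qed
    \<comment> \<open>The next Picard iterate: it starts at \<open>v\<close> and integrates the
      right-hand side evaluated at the old iterate \<open>z\<close>.\<close>
    define q :: "real \<Rightarrow> real^'n" where "q = (\<lambda>t. \<chi> j. v $ j + integral {0..t} (p j))"
    define q' :: "real \<Rightarrow> real^'n" where "q' = (\<lambda>t. \<chi> j. p j t)"
    have qj: "((\<lambda>t. q t $ j) has_real_derivative p j t) (at t within {0..b})" if "t \<in> {0..b}" for t j
      using integral_has_vector_derivative[OF Ck_Icc_continuous_on[OF p] that, of j]
      by (auto simp: q_def has_real_derivative_iff_has_vector_derivative intro!: derivative_eq_intros)
    have "Ck_Icc b k (\<lambda>t. q t $ j)" for j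
    proof (rule Ck_Icc_SucD)
      show "Ck_Icc b (Suc k) (\<lambda>t. q t $ j)"
        unfolding Ck_Icc.simps by (intro exI[of _ "p j"] conjI ballI qj p)
    qed
    moreover have "(q has_vector_derivative q' t) (at t within {0..b})" if "t \<in> {0..b}" for t
      by (rule has_vector_derivative_vec) (use qj[OF that] in \<open>simp add: q'_def\<close>)
    moreover have "q 0 = v" by (simp add: q_def vec_eq_iff)
    moreover have "\<bar>q' t $ j + (\<Sum>i\<in>UNIV. q t $ i * B i j t)\<bar> \<le> (\<Sum>i\<in>(UNIV::'n set). C * M) * t ^ Suc N"
      if t: "t \<in> {0..b}" for t j
    proof -
      \<comment> \<open>The sign of \<open>C\<close> is not prescribed; the residual bound forces it
        to be nonnegative once \<open>t\<close> is positive, and at \<open>t = 0\<close> the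
        comparison below is trivial.\<close>
      have C0: "0 \<le> C" if "t > 0"
        using order_trans[OF abs_ge_zero res[OF t, of undefined]] zero_less_power[OF that, of N] by (simp add: zero_le_mult_iff)
      \<comment> \<open>Both iterates start at \<open>v\<close>, and the derivative of
        \<open>q - z\<close> is minus the residual of \<open>z\<close>; integration gains one power
        of \<open>t\<close>.\<close>
      have diff: "\<bar>q t $ i - z t $ i\<bar> \<le> C * t ^ N * t" for i
      proof -
        have "norm ((q t $ i - z t $ i) - (q 0 $ i - z 0 $ i)) \<le> C * t ^ N * t"
        proof (rule vector_derivative_bound_from_0[OF _ _ t, where f' = "\<lambda>s. p i s - z' s $ i"])
          fix s assume "s \<in> {0..b}"
          then show "((\<lambda>s. q s $ i - z s $ i) has_vector_derivative p i s - z' s $ i) (at s within {0..b})"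
            unfolding has_real_derivative_iff_has_vector_derivative[symmetric]
            by (intro DERIV_diff qj has_real_derivative_vec_nth der)
        next
          fix s assume s: "s \<in> {0..t}"
          then have "\<bar>p i s - z' s $ i\<bar> \<le> C * s ^ N"
            using res[of s i] t by (auto simp: p_def abs_minus_commute)
          also have "\<dots> \<le> C * t ^ N"
          proof (cases "t = 0")
            case False
            then show ?thesis
              using s t C0 by (intro mult_left_mono power_mono) auto
          qed (use s in auto)
          finally show "norm (p i s - z' s $ i) \<le> C * t ^ N" by simp
        qed
        then show ?thesis by (simp add: q_def z0)
      qed
      \<comment> \<open>Since \<open>q'\<close> is computed from \<open>z\<close>, the residual of
        \<open>q\<close> is the transposed coefficient matrix applied to \<open>q - z\<close> and
        inherits the gained power.\<close>
      have "q' t $ j + (\<Sum>i\<in>UNIV. q t $ i * B i j t) = (\<Sum>i\<in>UNIV. (q t $ i - z t $ i) * B i j t)"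
        by (simp add: q'_def p_def left_diff_distrib sum_subtractf)
      also have "\<bar>\<dots>\<bar> \<le> (\<Sum>i\<in>UNIV. \<bar>(q t $ i - z t $ i) * B i j t\<bar>)" by (rule sum_abs)
      also have "\<dots> \<le> (\<Sum>i\<in>(UNIV::'n set). (C * t ^ N * t) * M)"
        using order_trans[OF abs_ge_zero diff]
        by (intro sum_mono) (auto simp: abs_mult intro!: mult_mono diff M t)
      also have "\<dots> = (\<Sum>i\<in>(UNIV::'n set). C * M) * t ^ Suc N" by simp
      finally show ?thesis .
    qed
    ultimately show ?case
      by (intro exI[of _ q] exI[of _ q'] exI[of _ "\<Sum>i\<in>(UNIV::'n set). C * M"] conjI ballI allI)
  qed
  then show ?thesis using that by blast
qed

text \<open>Adds and subtracts the double sum of \<open>z $ i * e $ j * D i j\<close>. The first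
  part then contains the adjoint residual for the matrix with entries
  \<open>A $ i $ j + D i j\<close>, the second the error of replacing \<open>d\<close> by its
  linearization.\<close>

lemma adjoint_identity:
  fixes A :: "real^'n^'n" and z z' e d :: "real^'n"
  shows "z' \<bullet> e + z \<bullet> (A *v e + d) =
    (\<Sum>j\<in>UNIV. e $ j * (z' $ j + (\<Sum>i\<in>UNIV. z $ i * (A $ i $ j + D i j)))) +
    (\<Sum>i\<in>UNIV. z $ i * (d $ i - (\<Sum>j\<in>UNIV. e $ j * D i j)))"
proof -
  have "(\<Sum>j\<in>UNIV. e $ j * (\<Sum>i\<in>UNIV. z $ i * (A $ i $ j + D i j))) =
      (\<Sum>i\<in>UNIV. \<Sum>j\<in>UNIV. e $ j * (z $ i * (A $ i $ j + D i j)))"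
    unfolding sum_distrib_left by (rule sum.swap)
  then show ?thesis
    by (simp add: inner_vec_def matrix_vector_mult_def algebra_simps sum.distrib sum_subtractf
        sum_distrib_left)
qed

subsection \<open>The projection and the step equation\<close>

text \<open>Each \<open>\<psi> i\<close> lies in its own span, hence agrees on \<open>{0..1}\<close>
  with a combination of the continuous functions \<open>f j\<close>.\<close>

lemma orthonormal_basis_continuous:
  assumes "orthonormal_basis01 r \<psi> f" "\<And>j. j < r \<Longrightarrow> continuous_on {0..1} (f j)" "i < r"
  shows "continuous_on {0..1} (\<psi> i)"
proof -
  have "\<psi> i \<in> span01 r \<psi>"
    unfolding span01_def using \<open>i < r\<close>
    by (auto intro!: exI[of _ "\<lambda>j. if j = i then 1 else 0"] simp: if_distrib[of "\<lambda>c. c * _"] cong: if_cong)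
  then obtain c where "\<forall>\<tau>\<in>{0..1}. \<psi> i \<tau> = (\<Sum>j<r. c j * f j \<tau>)"
    using assms(1) unfolding orthonormal_basis01_def span01_def by auto
  moreover have "continuous_on {0..1} (\<lambda>\<tau>. \<Sum>j<r. c j * f j \<tau>)"
    using assms(2) by (intro continuous_intros) auto
  ultimately show ?thesis
    using continuous_on_cong[of "{0..1}" "{0..1}" "\<psi> i" "\<lambda>\<tau>. \<Sum>j<r. c j * f j \<tau>"] by auto
qed

text \<open>The kernel has finite rank, so the variables \<open>\<tau>\<close> and
  \<open>\<sigma>\<close> separate. Continuity of projections and orthogonality relations reduce in
  this way to the basis functions.\<close>

lemma proj_eq_sum:
  fixes w :: "real \<Rightarrow> real^'n"
  assumes "\<And>i. i < r \<Longrightarrow> continuous_on {0..1} (\<psi> i)" "continuous_on {0..1} w"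
  shows "proj r \<psi> w \<tau> = (\<Sum>i<r. \<psi> i \<tau> *\<^sub>R integral {0..1} (\<lambda>\<sigma>. \<psi> i \<sigma> *\<^sub>R w \<sigma>))"
proof -
  have int: "(\<lambda>\<sigma>. \<psi> i \<sigma> *\<^sub>R w \<sigma>) integrable_on {0..1}" if "i < r" for i
    using assms that by (intro integrable_continuous_real continuous_intros) auto
  have "proj r \<psi> w \<tau> = integral {0..1} (\<lambda>\<sigma>. \<Sum>i<r. \<psi> i \<tau> *\<^sub>R (\<psi> i \<sigma> *\<^sub>R w \<sigma>))"
    by (simp add: proj_def Pker_def scaleR_sum_left)
  also have "\<dots> = (\<Sum>i<r. integral {0..1} (\<lambda>\<sigma>. \<psi> i \<tau> *\<^sub>R (\<psi> i \<sigma> *\<^sub>R w \<sigma>)))"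
    using int by (intro integral_sum integrable_cmul) auto
  finally show ?thesis by (simp only: integral_cmul)
qed

lemma continuous_on_proj:
  fixes w :: "real \<Rightarrow> real^'n"
  assumes "\<And>i. i < r \<Longrightarrow> continuous_on {0..1} (\<psi> i)" "continuous_on {0..1} w"
  shows "continuous_on {0..1} (proj r \<psi> w)"
proof -
  have "proj r \<psi> w = (\<lambda>\<tau>. \<Sum>i<r. \<psi> i \<tau> *\<^sub>R integral {0..1} (\<lambda>\<sigma>. \<psi> i \<sigma> *\<^sub>R w \<sigma>))"
    by (rule ext) (rule proj_eq_sum[OF assms])
  then show ?thesis using assms by (auto intro!: continuous_intros)
qed

lemma proj_diff:
  fixes v w :: "real \<Rightarrow> real^'n"
  assumes "\<And>i. i < r \<Longrightarrow> continuous_on {0..1} (\<psi> i)" "continuous_on {0..1} v" "continuous_on {0..1} w"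
  shows "proj r \<psi> (\<lambda>\<sigma>. v \<sigma> - w \<sigma>) \<tau> = proj r \<psi> v \<tau> - proj r \<psi> w \<tau>"
proof -
  have "(\<lambda>\<sigma>. Pker r \<psi> \<tau> \<sigma> *\<^sub>R v \<sigma>) integrable_on {0..1}" "(\<lambda>\<sigma>. Pker r \<psi> \<tau> \<sigma> *\<^sub>R w \<sigma>) integrable_on {0..1}"
    unfolding Pker_def using assms by (auto intro!: integrable_continuous_real continuous_intros)
  then show ?thesis
    by (simp add: proj_def scaleR_diff_right integral_diff)
qed

lemma norm_proj_le:
  fixes w :: "real \<Rightarrow> real^'n"
  assumes "\<And>i. i < r \<Longrightarrow> continuous_on {0..1} (\<psi> i)" "continuous_on {0..1} w"
    and "\<And>\<sigma>. \<sigma> \<in> {0..1} \<Longrightarrow> \<bar>Pker r \<psi> \<tau> \<sigma>\<bar> \<le> K" and "\<And>\<sigma>. \<sigma> \<in> {0..1} \<Longrightarrow> norm (w \<sigma>) \<le> m"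
  shows "norm (proj r \<psi> w \<tau>) \<le> K * m"
proof -
  have "norm (proj r \<psi> w \<tau>) \<le> K * m * (1 - 0)"
    unfolding proj_def
  proof (rule integral_bound)
    show "continuous_on {0..1} (\<lambda>\<sigma>. Pker r \<psi> \<tau> \<sigma> *\<^sub>R w \<sigma>)"
      unfolding Pker_def using assms by (intro continuous_intros) auto
    fix \<sigma> :: real assume "\<sigma> \<in> {0..1}"
    then show "norm (Pker r \<psi> \<tau> \<sigma> *\<^sub>R w \<sigma>) \<le> K * m"
      using mult_mono[OF assms(3,4)] order_trans[OF abs_ge_zero assms(3)] by simp
  qed simp
  then show ?thesis by simp
qed

text \<open>By orthonormality the defect \<open>proj r \<psi> w \<tau> - w \<tau>\<close> is
  orthogonal to every basis function, so subtracting from \<open>z\<close> its own projection leaves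
  the integral unchanged. Afterwards both factors are projection defects.\<close>

lemma integral_inner_proj_residual:
  fixes w z :: "real \<Rightarrow> real^'n"
  assumes cont: "\<And>i. i < r \<Longrightarrow> continuous_on {0..1} (\<psi> i)"
    and orth: "\<And>i j. i < r \<Longrightarrow> j < r \<Longrightarrow> inner01 (\<psi> i) (\<psi> j) = (if i = j then 1 else 0)"
    and w: "continuous_on {0..1} w" and z: "continuous_on {0..1} z"
  shows "integral {0..1} (\<lambda>\<tau>. z \<tau> \<bullet> (proj r \<psi> w \<tau> - w \<tau>)) =
    integral {0..1} (\<lambda>\<tau>. (z \<tau> - proj r \<psi> z \<tau>) \<bullet> (proj r \<psi> w \<tau> - w \<tau>))"
proof -
  let ?\<delta> = "\<lambda>\<tau>. proj r \<psi> w \<tau> - w \<tau>"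
  define c where "c = (\<lambda>i. integral {0..1} (\<lambda>\<sigma>. \<psi> i \<sigma> *\<^sub>R w \<sigma>))"
  define d where "d = (\<lambda>i. integral {0..1} (\<lambda>\<sigma>. \<psi> i \<sigma> *\<^sub>R z \<sigma>))"
  note pw = continuous_on_proj[OF cont w] and pz = continuous_on_proj[OF cont z]
  have zero: "integral {0..1} (\<lambda>\<tau>. \<psi> i \<tau> *\<^sub>R ?\<delta> \<tau>) = 0" if i: "i < r" for i
  proof -
    have "integral {0..1} (\<lambda>\<tau>. \<psi> i \<tau> *\<^sub>R ?\<delta> \<tau>) =
        integral {0..1} (\<lambda>\<tau>. \<psi> i \<tau> *\<^sub>R proj r \<psi> w \<tau>) - c i"
      unfolding c_def scaleR_diff_right using cont[OF i] w pw
      by (intro integral_diff integrable_continuous_real continuous_intros) auto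
    also have "integral {0..1} (\<lambda>\<tau>. \<psi> i \<tau> *\<^sub>R proj r \<psi> w \<tau>) =
        integral {0..1} (\<lambda>\<tau>. \<Sum>j<r. (\<psi> i \<tau> * \<psi> j \<tau>) *\<^sub>R c j)"
      by (simp add: proj_eq_sum[OF cont w] c_def scaleR_sum_right)
    also have "\<dots> = (\<Sum>j<r. integral {0..1} (\<lambda>\<tau>. (\<psi> i \<tau> * \<psi> j \<tau>) *\<^sub>R c j))"
      using cont i by (intro integral_sum integrable_continuous_real continuous_intros) auto
    also have "\<dots> = (\<Sum>j<r. (if i = j then 1 else 0) *\<^sub>R c j)"
    proof (rule sum.cong[OF refl])
      fix j assume "j \<in> {..<r}"
      then have j: "j < r" by simp
      have "(\<lambda>\<tau>. \<psi> i \<tau> * \<psi> j \<tau>) integrable_on {0..1}"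
        using cont i j by (intro integrable_continuous_real continuous_intros) auto
      then have "((\<lambda>\<tau>. (\<psi> i \<tau> * \<psi> j \<tau>) *\<^sub>R c j) has_integral inner01 (\<psi> i) (\<psi> j) *\<^sub>R c j) {0..1}"
        unfolding inner01_def inner_real_def
        by (intro has_integral_scaleR_left integrable_integral)
      then show "integral {0..1} (\<lambda>\<tau>. (\<psi> i \<tau> * \<psi> j \<tau>) *\<^sub>R c j) = (if i = j then 1 else 0) *\<^sub>R c j"
        using orth[OF i j] by (simp add: integral_unique)
    qed
    also have "\<dots> = c i" using i by (simp add: if_distrib[of "\<lambda>x. x *\<^sub>R _"] cong: if_cong)
    finally show ?thesis by simp
  qed
  have "integral {0..1} (\<lambda>\<tau>. proj r \<psi> z \<tau> \<bullet> ?\<delta> \<tau>) =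
      integral {0..1} (\<lambda>\<tau>. \<Sum>i<r. d i \<bullet> (\<psi> i \<tau> *\<^sub>R ?\<delta> \<tau>))"
    by (simp add: proj_eq_sum[OF cont z] d_def inner_sum_left)
  also have "\<dots> = (\<Sum>i<r. integral {0..1} (\<lambda>\<tau>. d i \<bullet> (\<psi> i \<tau> *\<^sub>R ?\<delta> \<tau>)))"
    using cont pw w by (intro integral_sum integrable_continuous_real continuous_intros) auto
  also have "\<dots> = 0"
  proof (rule sum.neutral, rule ballI)
    fix i assume "i \<in> {..<r}"
    then have i: "i < r" by simp
    have "(\<lambda>\<tau>. \<psi> i \<tau> *\<^sub>R ?\<delta> \<tau>) integrable_on {0..1}"
      using cont[OF i] pw w by (intro integrable_continuous_real continuous_intros) auto
    from integral_linear[OF this bounded_linear_inner_right, of "d i"]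
    show "integral {0..1} (\<lambda>\<tau>. d i \<bullet> (\<psi> i \<tau> *\<^sub>R ?\<delta> \<tau>)) = 0"
      using zero[OF i] by (simp add: o_def)
  qed
  finally have "integral {0..1} (\<lambda>\<tau>. proj r \<psi> z \<tau> \<bullet> ?\<delta> \<tau>) = 0" .
  moreover have "integral {0..1} (\<lambda>\<tau>. (z \<tau> - proj r \<psi> z \<tau>) \<bullet> ?\<delta> \<tau>) =
      integral {0..1} (\<lambda>\<tau>. z \<tau> \<bullet> ?\<delta> \<tau>) - integral {0..1} (\<lambda>\<tau>. proj r \<psi> z \<tau> \<bullet> ?\<delta> \<tau>)"
    unfolding inner_diff_left using z pz pw w
    by (intro integral_diff integrable_continuous_real continuous_intros) auto
  ultimately show ?thesis by simp
qed

text \<open>Including the limit \<open>h = 0\<close> makes the parameter set compact, so one bound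
  serves all stepsizes, however small.\<close>

lemma Pker_bounded:
  assumes "kernel_extends_smoothly r h0 \<psi>"
  obtains K where "0 \<le> K"
    "\<And>h \<tau> \<sigma>. h \<in> {0<..h0} \<Longrightarrow> \<tau> \<in> {0..1} \<Longrightarrow> \<sigma> \<in> {0..1} \<Longrightarrow> \<bar>Pker r (\<psi> h) \<tau> \<sigma>\<bar> \<le> K"
proof -
  let ?S = "{0..h0} \<times> {0..1::real} \<times> {0..1::real}"
  obtain D where D: "\<forall>h\<in>{0<..h0}. \<forall>\<tau>\<in>{0..1}. \<forall>\<sigma>\<in>{0..1}. D 0 h \<tau> \<sigma> = Pker r (\<psi> h) \<tau> \<sigma>"
    and "continuous_on ?S (\<lambda>(h, \<tau>, \<sigma>). (D (0::nat) h \<tau> \<sigma> :: real))"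
    using assms unfolding kernel_extends_smoothly_def by blast
  then have "bounded ((\<lambda>(h, \<tau>, \<sigma>). D 0 h \<tau> \<sigma>) ` ?S)"
    by (intro compact_imp_bounded compact_continuous_image compact_Times compact_Icc)
  then obtain K where "0 < K" and K: "\<forall>x\<in>?S. norm (case x of (h, \<tau>, \<sigma>) \<Rightarrow> D 0 h \<tau> \<sigma>) \<le> K"
    unfolding bounded_pos by blast
  show ?thesis
  proof (rule that)
    show "0 \<le> K" using \<open>0 < K\<close> by simp
    fix h \<tau> \<sigma> :: real assume *: "h \<in> {0<..h0}" "\<tau> \<in> {0..1}" "\<sigma> \<in> {0..1}"
    then have "D 0 h \<tau> \<sigma> = Pker r (\<psi> h) \<tau> \<sigma>" using D by blast
    then show "\<bar>Pker r (\<psi> h) \<tau> \<sigma>\<bar> \<le> K"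
      using bspec[OF K, of "(h, \<tau>, \<sigma>)"] * by simp
  qed
qed

text \<open>The substitution \<open>s = \<xi> * \<tau>\<close>, carried out by differentiating the
  integral function, so that \<open>\<tau> = 0\<close> needs no separate treatment.\<close>

lemma integral_scaled_interval:
  fixes k :: "real \<Rightarrow> 'a::banach"
  assumes k: "continuous_on {0..1} k" and \<tau>: "\<tau> \<in> {0..1}"
  shows "\<tau> *\<^sub>R integral {0..1} (\<lambda>\<xi>. k (\<xi> * \<tau>)) = integral {0..\<tau>} k"
proof -
  let ?J = "\<lambda>t. integral {0..t} k"
  have sub: "(\<lambda>\<xi>. \<xi> * \<tau>) ` {0..1} \<subseteq> {0..1}"
    using \<tau> by (auto intro: mult_le_one)
  have "((\<lambda>\<xi>. \<tau> *\<^sub>R k (\<xi> * \<tau>)) has_integral ?J (1 * \<tau>) - ?J (0 * \<tau>)) {0..1}"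
  proof (rule fundamental_theorem_of_calculus[where f = "\<lambda>\<xi>. ?J (\<xi> * \<tau>)"])
    fix \<xi> :: real assume \<xi>: "\<xi> \<in> {0..1}"
    have "((\<lambda>\<xi>. \<xi> * \<tau>) has_vector_derivative \<tau>) (at \<xi> within {0..1})"
      by (auto intro!: derivative_eq_intros)
    moreover have "(?J has_vector_derivative k (\<xi> * \<tau>)) (at (\<xi> * \<tau>) within (\<lambda>\<xi>. \<xi> * \<tau>) ` {0..1})"
    proof (rule has_vector_derivative_within_subset[OF integral_has_vector_derivative[OF k] sub])
      show "\<xi> * \<tau> \<in> {0..1}" using sub \<xi> by blast
    qed
    ultimately show "((\<lambda>\<xi>. ?J (\<xi> * \<tau>)) has_vector_derivative \<tau> *\<^sub>R k (\<xi> * \<tau>)) (at \<xi> within {0..1})"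
      using vector_diff_chain_within[of "\<lambda>\<xi>. \<xi> * \<tau>" \<tau> \<xi> "{0..1}" ?J] by (simp add: o_def)
  qed simp
  then show ?thesis
    by (simp add: integral_unique flip: integral_cmul)
qed

text \<open>
  Differential form of a step: the integral term is Duhamel's formula for the forcing \<open>\<P>\<^sub>h g(u)\<close>.
\<close>

lemma ECr_step_ode:
  fixes A :: "real^'n^'n"
  assumes cont: "\<And>i. i < r \<Longrightarrow> continuous_on {0..1} (\<psi> i)"
    and gu: "continuous_on {0..1} (\<lambda>\<sigma>. g (u \<sigma>))"
    and step: "ECr_step r \<psi> h A g y0 u"
  shows "u 0 = y0"
    and "\<And>\<tau>. \<tau> \<in> {0..1} \<Longrightarrow>
      (u has_vector_derivative h *\<^sub>R (A *v u \<tau> + proj r \<psi> (\<lambda>\<sigma>. g (u \<sigma>)) \<tau>)) (at \<tau> within {0..1})"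
proof -
  show "u 0 = y0"
    using step by (simp add: ECr_step_def mexp_0)
  let ?E = "\<lambda>t. mexp (t *\<^sub>R A)"
  define p where "p = proj r \<psi> (\<lambda>\<sigma>. g (u \<sigma>))"
  define c where "c = (\<lambda>i. integral {0..1} (\<lambda>\<sigma>. \<psi> i \<sigma> *\<^sub>R g (u \<sigma>)))"
  have p_sum: "p \<tau> = (\<Sum>i<r. \<psi> i \<tau> *\<^sub>R c i)" for \<tau>
    by (simp add: p_def c_def proj_eq_sum[OF cont gu])
  have p_cont: "continuous_on {0..1} p"
    unfolding p_def by (rule continuous_on_proj[OF cont gu])
  have E_cont: "continuous_on S (\<lambda>x. ?E (f x))" if "continuous_on S f" for S :: "real set" and f
    by (rule continuous_on_compose2[OF _ that subset_UNIV])
      (rule continuous_on_vector_derivative[OF mexp_has_vector_derivative])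
  \<comment> \<open>Duhamel's integrand with the factor \<open>?E (\<tau> * h)\<close> taken out;
    what remains no longer depends on the upper limit \<open>\<tau>\<close>.\<close>
  define k where "k = (\<lambda>s. ?E (- s * h) *v p s)"
  have k_cont: "continuous_on {0..1} k"
    unfolding k_def
    by (intro bounded_bilinear.continuous_on[OF bounded_bilinear_matrix_vector] E_cont p_cont continuous_intros)
  \<comment> \<open>The integrations over \<open>\<sigma>\<close> and \<open>\<xi>\<close> are
    interchanged without Fubini's theorem: the kernel is a finite sum of products, so the matrices
    \<open>X i\<close> carry the \<open>\<xi>\<close>-integrals and the vectors \<open>c i\<close>
    the \<open>\<sigma>\<close>-integrals.\<close>
  have forcing: "\<tau> *\<^sub>R integral {0..1} (\<lambda>\<sigma>. Abar r \<psi> h A \<tau> \<sigma> *v g (u \<sigma>)) = ?E (\<tau> * h) *v integral {0..\<tau>} k"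
    if \<tau>: "\<tau> \<in> {0..1}" for \<tau>
  proof -
    have \<psi>\<tau>: "continuous_on {0..1} (\<lambda>\<xi>. \<psi> i (\<xi> * \<tau>))" if "i < r" for i
      by (rule continuous_on_compose2[OF cont[OF that]])
        (use \<tau> in \<open>auto intro!: continuous_intros mult_le_one\<close>)
    define X where "X = (\<lambda>i. integral {0..1} (\<lambda>\<xi>. \<psi> i (\<xi> * \<tau>) *\<^sub>R ?E ((1 - \<xi>) * \<tau> * h)))"
    have X_int: "(\<lambda>\<xi>. \<psi> i (\<xi> * \<tau>) *\<^sub>R ?E ((1 - \<xi>) * \<tau> * h)) integrable_on {0..1}" if "i < r" for i
      using \<psi>\<tau>[OF that] by (intro integrable_continuous_real continuous_on_scaleR E_cont continuous_intros)
    have Abar_eq: "Abar r \<psi> h A \<tau> \<sigma> = (\<Sum>i<r. \<psi> i \<sigma> *\<^sub>R X i)" for \<sigma>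
    proof -
      have "Abar r \<psi> h A \<tau> \<sigma> =
          integral {0..1} (\<lambda>\<xi>. \<Sum>i<r. \<psi> i \<sigma> *\<^sub>R (\<psi> i (\<xi> * \<tau>) *\<^sub>R ?E ((1 - \<xi>) * \<tau> * h)))"
        by (simp add: Abar_def Pker_def scaleR_sum_left mult.commute)
      also have "\<dots> = (\<Sum>i<r. integral {0..1} (\<lambda>\<xi>. \<psi> i \<sigma> *\<^sub>R (\<psi> i (\<xi> * \<tau>) *\<^sub>R ?E ((1 - \<xi>) * \<tau> * h))))"
        by (intro integral_sum integrable_cmul X_int) auto
      finally show ?thesis by (simp only: integral_cmul X_def)
    qed
    have gu_int: "(\<lambda>\<sigma>. \<psi> i \<sigma> *\<^sub>R g (u \<sigma>)) integrable_on {0..1}" if "i < r" for i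
      using cont[OF that] gu by (intro integrable_continuous_real continuous_on_scaleR)
    have "integral {0..1} (\<lambda>\<sigma>. Abar r \<psi> h A \<tau> \<sigma> *v g (u \<sigma>)) =
        integral {0..1} (\<lambda>\<sigma>. \<Sum>i<r. X i *v (\<psi> i \<sigma> *\<^sub>R g (u \<sigma>)))"
      by (simp add: Abar_eq bounded_bilinear.sum_left[OF bounded_bilinear_matrix_vector]
          matrix_vector_mult_scaleR scaleR_matrix_vector_assoc)
    also have "\<dots> = (\<Sum>i<r. integral {0..1} (\<lambda>\<sigma>. X i *v (\<psi> i \<sigma> *\<^sub>R g (u \<sigma>))))"
      using gu_int by (intro integral_sum integrable_linear[OF _ matrix_vector_mul_bounded_linear, unfolded o_def]) auto
    also have "\<dots> = (\<Sum>i<r. X i *v c i)"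
      using integral_linear[OF gu_int matrix_vector_mul_bounded_linear]
      by (intro sum.cong) (auto simp: c_def o_def)
    also have "\<dots> = (\<Sum>i<r. integral {0..1} (\<lambda>\<xi>. (\<psi> i (\<xi> * \<tau>) *\<^sub>R ?E ((1 - \<xi>) * \<tau> * h)) *v c i))"
      using integral_linear[OF X_int bounded_bilinear.bounded_linear_left[OF bounded_bilinear_matrix_vector]]
      by (intro sum.cong) (auto simp: X_def o_def)
    also have "\<dots> = integral {0..1} (\<lambda>\<xi>. \<Sum>i<r. (\<psi> i (\<xi> * \<tau>) *\<^sub>R ?E ((1 - \<xi>) * \<tau> * h)) *v c i)"
      using integrable_linear[OF X_int bounded_bilinear.bounded_linear_left[OF bounded_bilinear_matrix_vector]]
      by (intro integral_sum[symmetric]) (auto simp: o_def)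
    also have "\<dots> = integral {0..1} (\<lambda>\<xi>. ?E (\<tau> * h) *v k (\<xi> * \<tau>))"
    proof (rule integral_cong)
      fix \<xi> :: real
      \<comment> \<open>Splitting the exponential pulls out the factor at time
        \<open>\<tau> * h\<close> and leaves exactly \<open>k (\<xi> * \<tau>)\<close>.\<close>
      have "?E ((1 - \<xi>) * \<tau> * h) = ?E (\<tau> * h) ** ?E (- (\<xi> * \<tau>) * h)"
        using mexp_diff_mult[of "(1 - \<xi>) * \<tau> * h" "- (\<xi> * \<tau>) * h" A] by (simp add: algebra_simps)
      then show "(\<Sum>i<r. (\<psi> i (\<xi> * \<tau>) *\<^sub>R ?E ((1 - \<xi>) * \<tau> * h)) *v c i) = ?E (\<tau> * h) *v k (\<xi> * \<tau>)"
        by (simp add: k_def p_sum matrix_vector_mul_assoc bounded_bilinear.sum_right[OF bounded_bilinear_matrix_vector]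
            matrix_mult_scaleR_right matrix_vector_mult_scaleR scaleR_matrix_vector_assoc[symmetric])
    qed
    also have "\<dots> = ?E (\<tau> * h) *v integral {0..1} (\<lambda>\<xi>. k (\<xi> * \<tau>))"
    proof -
      have "continuous_on {0..1} (\<lambda>\<xi>. k (\<xi> * \<tau>))"
        by (rule continuous_on_compose2[OF k_cont])
          (use \<tau> in \<open>auto intro!: continuous_intros mult_le_one\<close>)
      from integral_linear[OF integrable_continuous_real[OF this] matrix_vector_mul_bounded_linear]
      show ?thesis by (simp add: o_def)
    qed
    finally show ?thesis
      by (simp add: matrix_vector_mult_scaleR[symmetric] integral_scaled_interval[OF k_cont \<tau>])
  qed
  have u_eq: "u \<tau> = ?E (\<tau> * h) *v (y0 + h *\<^sub>R integral {0..\<tau>} k)" if "\<tau> \<in> {0..1}" for \<tau>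
  proof -
    have "u \<tau> = ?E (\<tau> * h) *v y0 + h *\<^sub>R (\<tau> *\<^sub>R integral {0..1} (\<lambda>\<sigma>. Abar r \<psi> h A \<tau> \<sigma> *v g (u \<sigma>)))"
      using step that by (simp add: ECr_step_def mult.commute)
    then show ?thesis
      by (simp add: forcing[OF that] matrix_vector_right_distrib matrix_vector_mult_scaleR)
  qed
  fix \<tau> :: real assume \<tau>: "\<tau> \<in> {0..1}"
  have "((\<lambda>\<tau>. \<tau> * h) has_vector_derivative h) (at \<tau> within {0..1})"
    by (auto intro!: derivative_eq_intros)
  from vector_diff_chain_within[OF this mexp_has_vector_derivative, of A]
  have dE: "((\<lambda>\<tau>. ?E (\<tau> * h)) has_vector_derivative h *\<^sub>R (A ** ?E (\<tau> * h))) (at \<tau> within {0..1})"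
    by (simp add: o_def)
  have dJ: "((\<lambda>\<tau>. y0 + h *\<^sub>R integral {0..\<tau>} k) has_vector_derivative h *\<^sub>R k \<tau>) (at \<tau> within {0..1})"
    using integral_has_vector_derivative[OF k_cont \<tau>] by (auto intro!: derivative_eq_intros)
  \<comment> \<open>The outer exponential cancels its inverse inside \<open>k\<close>, so
    differentiating the integral returns the projected forcing \<open>p\<close>.\<close>
  have inv: "?E (\<tau> * h) *v k \<tau> = p \<tau>"
    using mexp_diff_mult[of 0 "- \<tau> * h" A] by (simp add: k_def matrix_vector_mul_assoc mexp_0)
  have "((\<lambda>\<tau>. ?E (\<tau> * h) *v (y0 + h *\<^sub>R integral {0..\<tau>} k)) has_vector_derivative
      h *\<^sub>R (A *v u \<tau> + p \<tau>)) (at \<tau> within {0..1})"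
    using bounded_bilinear.has_vector_derivative[OF bounded_bilinear_matrix_vector dE dJ]
    by (simp add: u_eq[OF \<tau>] inv matrix_vector_mult_scaleR matrix_vector_mul_assoc scaleR_add_right
        scaleR_matrix_vector_assoc[symmetric] add.commute)
  then show "(u has_vector_derivative h *\<^sub>R (A *v u \<tau> + proj r \<psi> (\<lambda>\<sigma>. g (u \<sigma>)) \<tau>)) (at \<tau> within {0..1})"
    unfolding p_def by (rule has_vector_derivative_transform[OF \<tau>, rotated]) (simp add: u_eq)
qed

subsection \<open>Error bounds\<close>

text \<open>With \<open>m\<close> the maximum of \<open>norm (e \<sigma>)\<close>, the mean value
  inequality gives \<open>m \<le> h * a * m + h * c\<close>, and \<open>h * a \<le> 1 / 2\<close>
  absorbs the first term. The bound on \<open>d\<close> refers to the maximum over the whole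
  interval because the projection is nonlocal in \<open>\<tau>\<close>, which rules out a pointwise
  Gronwall estimate.\<close>

lemma small_step_bound:
  fixes e d :: "real \<Rightarrow> 'a::real_normed_vector"
  assumes e: "\<And>\<tau>. \<tau> \<in> {0..1} \<Longrightarrow> (e has_vector_derivative h *\<^sub>R d \<tau>) (at \<tau> within {0..1})"
    and "e 0 = 0" and "0 \<le> h" "0 \<le> a" "0 \<le> c" "h * a \<le> 1 / 2"
    and d: "\<And>m \<tau>. (\<And>\<sigma>. \<sigma> \<in> {0..1} \<Longrightarrow> norm (e \<sigma>) \<le> m) \<Longrightarrow> \<tau> \<in> {0..1} \<Longrightarrow> norm (d \<tau>) \<le> a * m + c"
    and "\<tau> \<in> {0..1}"
  shows "norm (e \<tau>) \<le> 2 * c * h"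
proof -
  have "continuous_on {0..1} (\<lambda>\<tau>. norm (e \<tau>))"
    by (intro continuous_on_norm continuous_on_vector_derivative[OF e])
  then obtain s where s: "s \<in> {0..1}" and max: "\<And>\<sigma>. \<sigma> \<in> {0..1} \<Longrightarrow> norm (e \<sigma>) \<le> norm (e s)"
    using continuous_attains_sup[of "{0..1::real}" "\<lambda>\<tau>. norm (e \<tau>)"] by auto
  let ?m = "norm (e s)"
  have "norm (e s - e 0) \<le> h * (a * ?m + c) * s"
  proof (rule vector_derivative_bound_from_0[OF e])
    fix \<sigma> assume "\<sigma> \<in> {0..s}"
    then show "norm (h *\<^sub>R d \<sigma>) \<le> h * (a * ?m + c)"
      using d[OF max, of \<sigma>] s \<open>0 \<le> h\<close> by (simp add: mult_left_mono)
  qed (use s in auto)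
  also have "\<dots> \<le> h * (a * ?m + c)"
    using s \<open>0 \<le> h\<close> \<open>0 \<le> a\<close> \<open>0 \<le> c\<close> by (intro mult_right_le_one_le) auto
  also have "\<dots> = (h * a) * ?m + h * c" by (simp add: algebra_simps)
  also have "\<dots> \<le> (1 / 2) * ?m + h * c"
    using assms(6) by (intro add_right_mono mult_right_mono) auto
  finally have "?m \<le> 2 * c * h" using \<open>e 0 = 0\<close> by (simp add: mult_ac)
  with max[OF \<open>\<tau> \<in> {0..1}\<close>] show ?thesis by simp
qed

text \<open>Integrates the derivative of \<open>z (\<tau> * h) \<bullet> e \<tau>\<close>. In the
  application \<open>d\<close> is the difference of \<open>g\<close> along the numerical and the
  exact solution, \<open>D\<close> the Jacobian of \<open>g\<close> along the exact one, and
  \<open>\<delta>\<close> the projection defect. Apart from \<open>\<delta>\<close>,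
  \<open>adjoint_identity\<close> leaves the adjoint residual times \<open>e\<close> and
  \<open>z\<close> times a quadratic remainder.\<close>

lemma weighted_endpoint_bound:
  fixes A :: "real^'n^'n" and e d \<delta> z z' :: "real \<Rightarrow> real^'n"
  assumes h: "0 < h" "h \<le> b" and e0: "e 0 = 0"
    and e: "\<And>\<tau>. \<tau> \<in> {0..1} \<Longrightarrow>
      (e has_vector_derivative h *\<^sub>R (A *v e \<tau> + d \<tau> + \<delta> \<tau>)) (at \<tau> within {0..1})"
    and z: "\<And>t. t \<in> {0..b} \<Longrightarrow> (z has_vector_derivative z' t) (at t within {0..b})"
    and res: "\<And>t j. t \<in> {0..b} \<Longrightarrow>
      \<bar>z' t $ j + (\<Sum>i\<in>UNIV. z t $ i * (A $ i $ j + D i j t))\<bar> \<le> C * t ^ N"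
    and rem: "\<And>\<tau> i. \<tau> \<in> {0..1} \<Longrightarrow>
      \<bar>d \<tau> $ i - (\<Sum>j\<in>UNIV. e \<tau> $ j * D i j (\<tau> * h))\<bar> \<le> L * (norm (e \<tau>))\<^sup>2"
    and zb: "\<And>t. t \<in> {0..b} \<Longrightarrow> norm (z t) \<le> Z"
    and eb: "\<And>\<tau>. \<tau> \<in> {0..1} \<Longrightarrow> norm (e \<tau>) \<le> E"
    and pos: "0 \<le> C" "0 \<le> L"
    and \<delta>: "continuous_on {0..1} \<delta>"
    and int: "\<bar>integral {0..1} (\<lambda>\<tau>. z (\<tau> * h) \<bullet> \<delta> \<tau>)\<bar> \<le> I"
  shows "\<bar>z h \<bullet> e 1\<bar> \<le> h * (I + real CARD('n) * (C * h ^ N * E + Z * L * E\<^sup>2))"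
proof -
  have th: "\<tau> * h \<in> {0..b}" if "\<tau> \<in> {0..1}" for \<tau>
    using that h mult_mono[of \<tau> 1 h b] by auto
  define q' where "q' = (\<lambda>\<tau>. (h *\<^sub>R z' (\<tau> * h)) \<bullet> e \<tau> + z (\<tau> * h) \<bullet> (h *\<^sub>R (A *v e \<tau> + d \<tau> + \<delta> \<tau>)))"
  have zh: "((\<lambda>\<tau>. z (\<tau> * h)) has_vector_derivative h *\<^sub>R z' (\<tau> * h)) (at \<tau> within {0..1})"
    if \<tau>: "\<tau> \<in> {0..1}" for \<tau>
  proof -
    have "((\<lambda>\<tau>. \<tau> * h) has_vector_derivative h) (at \<tau> within {0..1})"
      by (auto intro!: derivative_eq_intros)
    moreover have "(z has_vector_derivative z' (\<tau> * h)) (at (\<tau> * h) within (\<lambda>\<tau>. \<tau> * h) ` {0..1})"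
      by (rule has_vector_derivative_within_subset[OF z[OF th[OF \<tau>]]]) (use th in blast)
    ultimately show ?thesis
      using vector_diff_chain_within[of "\<lambda>\<tau>. \<tau> * h" h \<tau> "{0..1}" z] by (simp add: o_def)
  qed
  have q: "(q' has_integral z (1 * h) \<bullet> e 1 - z (0 * h) \<bullet> e 0) {0..1}"
  proof (rule fundamental_theorem_of_calculus)
    fix \<tau> :: real assume \<tau>: "\<tau> \<in> {0..1}"
    show "((\<lambda>\<tau>. z (\<tau> * h) \<bullet> e \<tau>) has_vector_derivative q' \<tau>) (at \<tau> within {0..1})"
      using bounded_bilinear.has_vector_derivative[OF bounded_bilinear_inner zh[OF \<tau>] e[OF \<tau>]]
      by (simp add: q'_def add.commute)
  qed simp
  let ?J = "integral {0..1} (\<lambda>\<tau>. z (\<tau> * h) \<bullet> \<delta> \<tau>)"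
  have "continuous_on {0..1} (\<lambda>\<tau>. z (\<tau> * h))"
    by (rule continuous_on_vector_derivative[OF zh])
  then have "((\<lambda>\<tau>. z (\<tau> * h) \<bullet> \<delta> \<tau>) has_integral ?J) {0..1}"
    using \<delta> by (intro integrable_integral integrable_continuous_real continuous_intros)
  \<comment> \<open>The contribution of \<open>\<delta>\<close> is split off as an integral;
    estimating it pointwise would lose the gain from orthogonality.\<close>
  from has_integral_diff[OF q has_integral_mult_right[OF this, of h]]
  have p: "((\<lambda>\<tau>. q' \<tau> - h * (z (\<tau> * h) \<bullet> \<delta> \<tau>)) has_integral (z h \<bullet> e 1 - h * ?J)) {0..1}"
    using e0 by simp
  have E0: "0 \<le> E" using order_trans[OF norm_ge_zero eb[of 0]] by simp
  have Z0: "0 \<le> Z" using order_trans[OF norm_ge_zero zb[of 0]] h by simp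
  let ?B = "h * (real CARD('n) * (C * h ^ N * E + Z * L * E\<^sup>2))"
  have "norm (z h \<bullet> e 1 - h * ?J) \<le> ?B * Henstock_Kurzweil_Integration.content {0..1::real}"
  proof (rule has_integral_bound_real[OF _ finite.emptyI p])
    show "0 \<le> ?B" using h pos E0 Z0 by simp
    show "norm (q' \<tau> - h * (z (\<tau> * h) \<bullet> \<delta> \<tau>)) \<le> ?B" if "\<tau> \<in> {0..1} - {}" for \<tau>
    proof -
      have \<tau>: "\<tau> \<in> {0..1}" using that by simp
      let ?t = "\<tau> * h"
      let ?r = "\<lambda>j. z' ?t $ j + (\<Sum>i\<in>UNIV. z ?t $ i * (A $ i $ j + D i j ?t))"
      let ?s = "\<lambda>i. d \<tau> $ i - (\<Sum>j\<in>UNIV. e \<tau> $ j * D i j ?t)"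
      have "q' \<tau> - h * (z ?t \<bullet> \<delta> \<tau>) = h * (z' ?t \<bullet> e \<tau> + z ?t \<bullet> (A *v e \<tau> + d \<tau>))"
        by (simp add: q'_def inner_add_right algebra_simps)
      also have "\<dots> = h * ((\<Sum>j\<in>UNIV. e \<tau> $ j * ?r j) + (\<Sum>i\<in>UNIV. z ?t $ i * ?s i))"
        by (simp only: adjoint_identity[where D = "\<lambda>i j. D i j ?t"])
      finally have eq: "norm (q' \<tau> - h * (z ?t \<bullet> \<delta> \<tau>)) =
          h * \<bar>(\<Sum>j\<in>UNIV. e \<tau> $ j * ?r j) + (\<Sum>i\<in>UNIV. z ?t $ i * ?s i)\<bar>"
        using h by (simp add: abs_mult)
      have "\<bar>\<Sum>j\<in>UNIV. e \<tau> $ j * ?r j\<bar> \<le> (\<Sum>j\<in>(UNIV::'n set). C * h ^ N) * norm (e \<tau>)"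
      proof (rule sum_mult_abs_le_norm)
        fix j
        have "\<bar>?r j\<bar> \<le> C * ?t ^ N" by (rule res[OF th[OF \<tau>]])
        also have "\<dots> \<le> C * h ^ N"
          using \<tau> h pos by (intro mult_left_mono power_mono) (auto simp: mult_le_cancel_right1)
        finally show "\<bar>?r j\<bar> \<le> C * h ^ N" .
      qed
      also have "\<dots> \<le> (\<Sum>j\<in>(UNIV::'n set). C * h ^ N) * E"
        using h pos by (intro mult_left_mono eb \<tau>) simp
      finally have 1: "\<bar>\<Sum>j\<in>UNIV. e \<tau> $ j * ?r j\<bar> \<le> real CARD('n) * (C * h ^ N * E)" by simp
      have "\<bar>\<Sum>i\<in>UNIV. z ?t $ i * ?s i\<bar> \<le> (\<Sum>i\<in>(UNIV::'n set). L * E\<^sup>2) * norm (z ?t)"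
      proof (rule sum_mult_abs_le_norm)
        fix i
        have "\<bar>?s i\<bar> \<le> L * (norm (e \<tau>))\<^sup>2" by (rule rem[OF \<tau>])
        also have "\<dots> \<le> L * E\<^sup>2"
          using eb[OF \<tau>] pos by (intro mult_left_mono power_mono) auto
        finally show "\<bar>?s i\<bar> \<le> L * E\<^sup>2" .
      qed
      also have "\<dots> \<le> (\<Sum>i\<in>(UNIV::'n set). L * E\<^sup>2) * Z"
        using pos by (intro mult_left_mono zb th \<tau>) simp
      finally have 2: "\<bar>\<Sum>i\<in>UNIV. z ?t $ i * ?s i\<bar> \<le> real CARD('n) * (Z * L * E\<^sup>2)"
        by (simp add: mult_ac)
      show ?thesis
        unfolding eq using 1 2 h by (intro mult_left_mono) (simp_all add: distrib_left)
    qed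
  qed
  then have "\<bar>z h \<bullet> e 1\<bar> \<le> ?B + h * \<bar>?J\<bar>"
    using h abs_mult[of h ?J] by simp
  also have "\<dots> \<le> ?B + h * I" using int h by simp
  finally show ?thesis by (simp add: algebra_simps)
qed

lemma bounded_on_Icc:
  fixes f :: "real \<Rightarrow> 'a::real_normed_vector"
  assumes "continuous_on {a..b} f"
  obtains B where "0 \<le> B" "\<And>t. t \<in> {a..b} \<Longrightarrow> norm (f t) \<le> B"
  using compact_imp_bounded[OF compact_continuous_image[OF assms compact_Icc]]
  unfolding bounded_pos by (metis image_eqI less_imp_le)

text \<open>\<open>ball\<close> keeps the numerical solutions in one compact set,
  \<open>kernel\<close> bounds the projections uniformly in \<open>h\<close>, and
  \<open>projection\<close> is the recalled approximation property, applied to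
  \<open>g (y (\<tau> * h))\<close> and to the adjoint function. The bases \<open>\<psi> h\<close>
  may be chosen independently for each \<open>h\<close>, as long as their kernels extend
  smoothly.\<close>

theorem theorem4:
  fixes Q M A :: "real^'n^'n"
    and V :: "real^'n \<Rightarrow> real" and gradV g :: "real^'n \<Rightarrow> real^'n"
    and y :: "real \<Rightarrow> real^'n" and y0 :: "real^'n"
    and r :: nat and h0 R :: real and T :: "real set"
    and \<phi> :: "nat \<Rightarrow> real \<Rightarrow> real"
    and \<psi> :: "real \<Rightarrow> nat \<Rightarrow> real \<Rightarrow> real"
    and u :: "real \<Rightarrow> real \<Rightarrow> real^'n"
  assumes "invertible Q" and "transpose M = M"
    and "smooth_on UNIV V" and "\<And>x. GDERIV V x :> gradV x"
    and A_def: "A = Q ** M" and g_def: "g = (\<lambda>x. Q *v gradV x)"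
    and "r \<ge> 1" and "h0 > 0"
    and exact: "\<And>t. t \<in> {0..h0} \<Longrightarrow>
          (y has_vector_derivative (A *v y t + g (y t))) (at t within {0..h0})" "y 0 = y0"
    and phi_smooth: "open T" "{0..h0} \<subseteq> T" "\<And>i. i < r \<Longrightarrow> smooth_on T (\<phi> i)"
    and phi_indep: "\<And>h. h \<in> {0<..h0} \<Longrightarrow> lin_indep01 r (\<lambda>i \<tau>. \<phi> i (\<tau> * h))"
    and psi_basis: "\<And>h. h \<in> {0<..h0} \<Longrightarrow> orthonormal_basis01 r (\<psi> h) (\<lambda>i \<tau>. \<phi> i (\<tau> * h))"
    and kernel: "kernel_extends_smoothly r h0 \<psi>"
    and projection: "\<And>w :: real \<Rightarrow> real \<Rightarrow> real^'n. regular r w \<Longrightarrow>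
          unif_bigo {0..1} (\<lambda>h \<tau>. proj r (\<psi> h) (w h) \<tau> - w h \<tau>) r"
    and step: "\<And>h. h \<in> {0<..h0} \<Longrightarrow> ECr_step r (\<psi> h) h A g y0 (u h)"
    and ball: "\<And>h \<tau>. h \<in> {0<..h0} \<Longrightarrow> \<tau> \<in> {0..1} \<Longrightarrow> u h \<tau> \<in> cball (mexp ((\<tau> * h) *\<^sub>R A) *v y0) R"
  shows "unif_bigo {0<..<1} (\<lambda>h \<tau>. u h \<tau> - y (\<tau> * h)) (r + 1) \<and>
         (\<lambda>h. norm (u h 1 - y h)) \<in> O[at_right 0](\<lambda>h. h ^ (2 * r + 1))"
proof -

  \<comment> \<open>Smoothness of the vector field and continuity of the data\<close>
  have g_smooth: "smooth_on UNIV (\<lambda>x. g x $ i)" for i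
  proof -
    \<comment> \<open>A component of \<open>Q *v gradV x\<close> is the derivative of
      \<open>V\<close> in the direction of a row of \<open>Q\<close>; this transfers the smoothness
      of \<open>V\<close> to \<open>g\<close>.\<close>
    have "(\<lambda>x. g x $ i) = (\<lambda>x. frechet_derivative V (at x) (Q $ i))"
    proof
      fix x
      have "frechet_derivative V (at x) = (\<lambda>v. v \<bullet> gradV x)"
        using assms(4)[of x] unfolding gderiv_def by (rule frechet_derivative_at[symmetric])
      then show "g x $ i = frechet_derivative V (at x) (Q $ i)"
        by (simp add: g_def matrix_vector_mult_def inner_vec_def)
    qed
    then show ?thesis using smooth_on_frechet_derivative[OF assms(3)] by simp
  qed
  have F_smooth: "smooth_on UNIV (\<lambda>x. (A *v x + g x) $ i)" for i
  proof -
    have "bounded_linear (\<lambda>x. (A *v x) $ i)"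
      by (rule bounded_linear_compose[OF bounded_linear_vec_nth matrix_vector_mul_bounded_linear])
    then have "smooth_on UNIV (\<lambda>x. (A *v x) $ i)"
      by (simp add: smooth_on_def Ck_on_bounded_linear)
    then show ?thesis using smooth_on_add[OF _ g_smooth] by simp
  qed
  have g_cont: "continuous_on S g" for S
    using continuous_on_vec_lambda[of S "\<lambda>i x. g x $ i"] smooth_on_continuous_on[OF g_smooth]
      continuous_on_subset[OF _ subset_UNIV] by auto
  have y_cont: "continuous_on {0..h0} y"
    by (rule continuous_on_vector_derivative[OF exact(1)])
  have th: "\<tau> * h \<in> {0..h0}" if "h \<in> {0<..h0}" "\<tau> \<in> {0..1}" for \<tau> h
    using that mult_mono[of \<tau> 1 h h0] by auto
  have yh_cont: "continuous_on {0..1} (\<lambda>\<tau>. y (\<tau> * h))" if "h \<in> {0<..h0}" for h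
    by (rule continuous_on_compose2[OF y_cont]) (auto intro!: continuous_intros th that)
  have u_cont: "continuous_on {0..1} (u h)" if "h \<in> {0<..h0}" for h
    using step[OF that] by (simp add: ECr_step_def)
  have gu_cont: "continuous_on {0..1} (\<lambda>\<tau>. g (u h \<tau>))"
    and gy_cont: "continuous_on {0..1} (\<lambda>\<tau>. g (y (\<tau> * h)))" if "h \<in> {0<..h0}" for h
    using u_cont[OF that] yh_cont[OF that] g_cont[of UNIV] by (auto intro: continuous_on_compose2)
  have \<psi>_cont: "continuous_on {0..1} (\<psi> h i)" if "h \<in> {0<..h0}" "i < r" for h i
  proof (rule orthonormal_basis_continuous[OF psi_basis[OF that(1)] _ that(2)])
    fix j assume "j < r"
    show "continuous_on {0..1} (\<lambda>\<tau>. \<phi> j (\<tau> * h))"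
      by (rule continuous_on_compose2[OF smooth_on_continuous_on[OF phi_smooth(3)[OF \<open>j < r\<close>]]])
        (use th[OF that(1)] phi_smooth(2) in \<open>auto intro!: continuous_intros\<close>)
  qed
  obtain K where K0: "0 \<le> K" and K: "\<And>h \<tau> \<sigma>. h \<in> {0<..h0} \<Longrightarrow> \<tau> \<in> {0..1} \<Longrightarrow> \<sigma> \<in> {0..1} \<Longrightarrow>
      \<bar>Pker r (\<psi> h) \<tau> \<sigma>\<bar> \<le> K"
    using Pker_bounded[OF kernel] by blast

  \<comment> \<open>A compact convex set containing the exact and the numerical solutions\<close>
  have "continuous_on {0..h0} (\<lambda>t. mexp (t *\<^sub>R A) *v y0)"
    by (intro bounded_bilinear.continuous_on[OF bounded_bilinear_matrix_vector] continuous_on_const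
        continuous_on_vector_derivative[OF mexp_has_vector_derivative])
  then obtain R1 where R1: "\<And>t. t \<in> {0..h0} \<Longrightarrow> norm (mexp (t *\<^sub>R A) *v y0) \<le> R1"
    by (rule bounded_on_Icc) blast
  obtain R2 where R2: "\<And>t. t \<in> {0..h0} \<Longrightarrow> norm (y t) \<le> R2"
    by (rule bounded_on_Icc[OF y_cont]) blast
  \<comment> \<open>The radius \<open>R1 + R\<close> accounts for the numerical solutions, which
    stay within \<open>R\<close> of the linear flow, and \<open>R2\<close> for the exact
    one.\<close>
  define X :: "(real^'n) set" where "X = cball 0 (max (R1 + R) R2)"
  have X: "compact X" "convex X" by (simp_all add: X_def)
  have yX: "y t \<in> X" if "t \<in> {0..h0}" for t
    using R2[OF that] by (simp add: X_def)
  have uX: "u h \<tau> \<in> X" if "h \<in> {0<..h0}" "\<tau> \<in> {0..1}" for h \<tau>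
    using ball[OF that] R1[OF th[OF that]] norm_triangle_sub[of "u h \<tau>" "mexp ((\<tau> * h) *\<^sub>R A) *v y0"]
    by (simp add: X_def dist_norm norm_minus_commute)

  \<comment> \<open>Lipschitz, linearization and operator-norm constants\<close>
  have "\<forall>i. \<exists>L\<ge>0. \<forall>x\<in>X. \<forall>z\<in>X. \<bar>g x $ i - g z $ i\<bar> \<le> L * norm (x - z)"
  proof
    fix i show "\<exists>L\<ge>0. \<forall>x\<in>X. \<forall>z\<in>X. \<bar>g x $ i - g z $ i\<bar> \<le> L * norm (x - z)"
      by (rule smooth_Lipschitz[OF g_smooth[of i] X]) blast
  qed
  from choice[OF this] obtain L1 where L1: "\<And>i. 0 \<le> L1 i"
    "\<And>i x z. x \<in> X \<Longrightarrow> z \<in> X \<Longrightarrow> \<bar>g x $ i - g z $ i\<bar> \<le> L1 i * norm (x - z)" by blast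
  define L where "L = (\<Sum>i\<in>UNIV. L1 i)"
  have L0: "0 \<le> L" unfolding L_def by (intro sum_nonneg L1)
  have L: "norm (g x - g z) \<le> L * norm (x - z)" if "x \<in> X" "z \<in> X" for x z
  proof -
    have "norm (g x - g z) \<le> (\<Sum>i\<in>UNIV. \<bar>(g x - g z) $ i\<bar>)" by (rule norm_le_l1_cart)
    also have "\<dots> \<le> (\<Sum>i\<in>UNIV. L1 i * norm (x - z))"
      using L1(2)[OF that] by (intro sum_mono) simp
    finally show ?thesis by (simp add: L_def sum_distrib_right)
  qed
  \<comment> \<open>The Jacobian of \<open>g\<close> along the exact solution; together with the
    entries of \<open>A\<close> it forms the coefficients of the adjoint equation.\<close>
  define D where "D = (\<lambda>i j t. frechet_derivative (\<lambda>x. g x $ i) (at (y t)) (axis j 1))"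
  have "\<forall>i. \<exists>L\<ge>0. \<forall>x\<in>X. \<forall>z\<in>X.
      \<bar>g x $ i - g z $ i - frechet_derivative (\<lambda>x. g x $ i) (at z) (x - z)\<bar> \<le> L * (norm (x - z))\<^sup>2"
  proof
    fix i show "\<exists>L\<ge>0. \<forall>x\<in>X. \<forall>z\<in>X.
      \<bar>g x $ i - g z $ i - frechet_derivative (\<lambda>x. g x $ i) (at z) (x - z)\<bar> \<le> L * (norm (x - z))\<^sup>2"
      by (rule smooth_linearization[OF g_smooth[of i] X]) blast
  qed
  from choice[OF this] obtain L2' where L2': "\<And>i. 0 \<le> L2' i" "\<And>i x z. x \<in> X \<Longrightarrow> z \<in> X \<Longrightarrow>
      \<bar>g x $ i - g z $ i - frechet_derivative (\<lambda>x. g x $ i) (at z) (x - z)\<bar> \<le> L2' i * (norm (x - z))\<^sup>2"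
    by blast
  define L2 where "L2 = (\<Sum>i\<in>UNIV. L2' i)"
  have L20: "0 \<le> L2" unfolding L2_def by (intro sum_nonneg L2')
  have L2: "\<bar>(g x - g (y t)) $ i - (\<Sum>j\<in>UNIV. (x - y t) $ j * D i j t)\<bar> \<le> L2 * (norm (x - y t))\<^sup>2"
    if "x \<in> X" "t \<in> {0..h0}" for x t i
  proof -
    have "L2' i \<le> L2" unfolding L2_def using L2' by (intro member_le_sum) auto
    have "\<bar>g x $ i - g (y t) $ i - frechet_derivative (\<lambda>x. g x $ i) (at (y t)) (x - y t)\<bar>
        \<le> L2' i * (norm (x - y t))\<^sup>2"
      by (rule L2'(2)[OF that(1) yX[OF that(2)]])
    also have "\<dots> \<le> L2 * (norm (x - y t))\<^sup>2"
      using \<open>L2' i \<le> L2\<close> by (rule mult_right_mono) simp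
    finally show ?thesis
      using has_derivative_axis_sum[OF smooth_on_has_derivative[OF g_smooth UNIV_I], of i "y t" "x - y t"]
      by (simp add: D_def)
  qed

  define a where "a = onorm ((*v) A)"
  have a0: "0 \<le> a" unfolding a_def by (intro onorm_pos_le matrix_vector_mul_bounded_linear)
  have a: "norm (A *v x) \<le> a * norm x" for x
    unfolding a_def by (intro onorm matrix_vector_mul_bounded_linear)

  \<comment> \<open>Projection defect along the exact solution and the error equation\<close>
  have "regular r (\<lambda>h \<tau>. g (y (\<tau> * h)))"
    by (rule regular_scaled[where z = "\<lambda>t. g (y t)", OF \<open>h0 > 0\<close>])
      (rule Ck_Icc_along_solution[OF F_smooth exact(1) g_smooth])
  from projection[OF this] obtain C0 where C0:
    "\<forall>\<^sub>F h in at_right 0. \<forall>\<tau>\<in>{0..1}.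
      norm (proj r (\<psi> h) (\<lambda>\<tau>. g (y (\<tau> * h))) \<tau> - g (y (\<tau> * h))) \<le> C0 * h ^ r"
    unfolding unif_bigo_def by blast
  \<comment> \<open>\<open>unif_bigo\<close> does not fix the sign of its constant; the absolute
    value makes it usable in products of bounds.\<close>
  define C1 where "C1 = \<bar>C0\<bar>"
  have C1: "0 \<le> C1" by (simp add: C1_def)
  define e where "e = (\<lambda>h \<tau>. u h \<tau> - y (\<tau> * h))"
  define \<delta> where "\<delta> = (\<lambda>h \<tau>. proj r (\<psi> h) (\<lambda>\<tau>. g (u h \<tau>)) \<tau> - g (u h \<tau>))"
  have e_der: "(e h has_vector_derivative
      h *\<^sub>R (A *v e h \<tau> + (proj r (\<psi> h) (\<lambda>\<tau>. g (u h \<tau>)) \<tau> - g (y (\<tau> * h))))) (at \<tau> within {0..1})"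
    if h: "h \<in> {0<..h0}" and \<tau>: "\<tau> \<in> {0..1}" for h \<tau>
  proof -
    have "((\<lambda>\<tau>. \<tau> * h) has_vector_derivative h) (at \<tau> within {0..1})"
      by (auto intro!: derivative_eq_intros)
    moreover have "(y has_vector_derivative A *v y (\<tau> * h) + g (y (\<tau> * h)))
        (at (\<tau> * h) within (\<lambda>\<tau>. \<tau> * h) ` {0..1})"
      by (rule has_vector_derivative_within_subset[OF exact(1)[OF th[OF h \<tau>]]]) (use th[OF h] in blast)
    ultimately have "((\<lambda>\<tau>. y (\<tau> * h)) has_vector_derivative h *\<^sub>R (A *v y (\<tau> * h) + g (y (\<tau> * h))))
        (at \<tau> within {0..1})"
      using vector_diff_chain_within[of "\<lambda>\<tau>. \<tau> * h" h \<tau> "{0..1}" y] by (simp add: o_def)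
    from has_vector_derivative_diff[OF ECr_step_ode(2)[OF \<psi>_cont[OF h] gu_cont[OF h] step[OF h] \<tau>] this]
    show ?thesis
      by (simp add: e_def matrix_vector_mult_diff_distrib algebra_simps)
  qed
  have e0: "e h 0 = 0" if "h \<in> {0<..h0}" for h
    using ECr_step_ode(1)[OF \<psi>_cont[OF that] gu_cont[OF that] step[OF that]] exact(2)
    by (simp add: e_def)

  \<comment> \<open>Stage order and the size of the projection defect\<close>
  define C2 where "C2 = 2 * C1"
  \<comment> \<open>Collects the three terms in the splitting of \<open>\<delta>\<close> below:
    \<open>K + 1\<close> counts the projected and the unprojected difference of \<open>g\<close>,
    whose surplus factor \<open>h\<close> is bounded by \<open>h0\<close>, and \<open>C1\<close> is
    the defect along the exact solution.\<close>
  define C3 where "C3 = (K + 1) * L * C2 * h0 + C1"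
  have C2: "0 \<le> C2" by (simp add: C2_def C1)
  have C3: "0 \<le> C3" using K0 L0 C2 C1 \<open>h0 > 0\<close> by (simp add: C3_def)
  \<comment> \<open>Here \<open>a\<close> comes from the linear part and \<open>K * L\<close> from
    the projected difference of \<open>g\<close>; the threshold is the one required by
    \<open>small_step_bound\<close>.\<close>
  have "\<forall>\<^sub>F h in at_right (0::real). h * (a + K * L) \<le> 1 / 2"
  proof -
    have "((\<lambda>h. h * (a + K * L)) \<longlongrightarrow> 0 * (a + K * L)) (at_right (0::real))"
      by (intro tendsto_intros)
    then have "\<forall>\<^sub>F h in at_right (0::real). h * (a + K * L) < 1 / 2"
      by (rule order_tendstoD) simp
    then show ?thesis by (rule eventually_mono) simp
  qed
  then have stage: "\<forall>\<^sub>F h in at_right 0. h \<in> {0<..h0} \<and>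
      (\<forall>\<tau>\<in>{0..1}. norm (e h \<tau>) \<le> C2 * h ^ (r + 1) \<and> norm (\<delta> h \<tau>) \<le> C3 * h ^ r)"
    using C0 eventually_at_right_0_le[OF \<open>h0 > 0\<close>]
  proof eventually_elim
    case (elim h)
    then have h: "h \<in> {0<..h0}" and h_pos: "0 < h" and h_small: "h * (a + K * L) \<le> 1 / 2"
      by auto
    let ?G = "\<lambda>\<tau>. g (u h \<tau>)" and ?Y = "\<lambda>\<tau>. g (y (\<tau> * h))"
    let ?P = "proj r (\<psi> h)"
    have C1h: "norm (?P ?Y \<tau> - ?Y \<tau>) \<le> C1 * h ^ r" if "\<tau> \<in> {0..1}" for \<tau>
    proof -
      have "norm (?P ?Y \<tau> - ?Y \<tau>) \<le> C0 * h ^ r" using elim(2) that by blast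
      also have "\<dots> \<le> C1 * h ^ r" using h_pos by (simp add: C1_def mult_right_mono)
      finally show ?thesis .
    qed
    have GY: "norm (?G \<tau> - ?Y \<tau>) \<le> L * norm (e h \<tau>)" if "\<tau> \<in> {0..1}" for \<tau>
      using L[OF uX[OF h that] yX[OF th[OF h that]]] by (simp add: e_def)
    have PGY: "norm (?P ?G \<tau> - ?P ?Y \<tau>) \<le> K * (L * m)"
      if m: "\<And>\<sigma>. \<sigma> \<in> {0..1} \<Longrightarrow> norm (e h \<sigma>) \<le> m" and \<tau>: "\<tau> \<in> {0..1}" for m \<tau>
    proof -
      have "norm (?P (\<lambda>\<sigma>. ?G \<sigma> - ?Y \<sigma>) \<tau>) \<le> K * (L * m)"
      proof (rule norm_proj_le[OF \<psi>_cont[OF h] _ K[OF h \<tau>]])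
        show "continuous_on {0..1} (\<lambda>\<sigma>. ?G \<sigma> - ?Y \<sigma>)"
          by (intro continuous_on_diff gu_cont gy_cont h)
        show "norm (?G \<sigma> - ?Y \<sigma>) \<le> L * m" if "\<sigma> \<in> {0..1}" for \<sigma>
          using GY[OF that] mult_left_mono[OF m[OF that] L0] by linarith
      qed
      then show ?thesis
        using proj_diff[OF \<psi>_cont[OF h] gu_cont[OF h] gy_cont[OF h]] by simp
    qed
    have e_bound: "norm (e h \<tau>) \<le> C2 * h ^ (r + 1)" if "\<tau> \<in> {0..1}" for \<tau>
    proof -
      have "norm (e h \<tau>) \<le> 2 * (C1 * h ^ r) * h"
      proof (rule small_step_bound[OF e_der[OF h] e0[OF h], where a = "a + K * L"])
        fix m \<tau> :: real
        assume m: "\<And>\<sigma>. \<sigma> \<in> {0..1} \<Longrightarrow> norm (e h \<sigma>) \<le> m" and \<tau>: "\<tau> \<in> {0..1}"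
        \<comment> \<open>Inserting the projection of \<open>g\<close> along the exact solution
          separates a term controlled by the error itself from one that is small by
          regularity.\<close>
        have "norm (A *v e h \<tau> + (?P ?G \<tau> - ?Y \<tau>)) =
            norm (A *v e h \<tau> + (?P ?G \<tau> - ?P ?Y \<tau>) + (?P ?Y \<tau> - ?Y \<tau>))"
          by simp
        also have "\<dots> \<le> norm (A *v e h \<tau>) + norm (?P ?G \<tau> - ?P ?Y \<tau>) + norm (?P ?Y \<tau> - ?Y \<tau>)"
          by (rule order_trans[OF norm_triangle_ineq]) (intro add_right_mono norm_triangle_ineq)
        also have "\<dots> \<le> a * m + K * (L * m) + C1 * h ^ r"
          by (rule add_mono[OF add_mono[OF order_trans[OF a mult_left_mono[OF m[OF \<tau>] a0]]
                PGY[OF m \<tau>]] C1h[OF \<tau>]])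
        finally show "norm (A *v e h \<tau> + (?P ?G \<tau> - ?Y \<tau>)) \<le> (a + K * L) * m + C1 * h ^ r"
          by (simp add: algebra_simps)
      qed (use that h_pos h_small a0 K0 L0 C1 in auto)
      then show ?thesis by (simp add: C2_def mult_ac)
    qed
    have \<delta>_bound: "norm (\<delta> h \<tau>) \<le> C3 * h ^ r" if \<tau>: "\<tau> \<in> {0..1}" for \<tau>
    proof -
      let ?m = "C2 * h ^ (r + 1)"
      have "norm (\<delta> h \<tau>) = norm ((?P ?G \<tau> - ?P ?Y \<tau>) + (?P ?Y \<tau> - ?Y \<tau>) - (?G \<tau> - ?Y \<tau>))"
        by (simp add: \<delta>_def)
      also have "\<dots> \<le> norm (?P ?G \<tau> - ?P ?Y \<tau>) + norm (?P ?Y \<tau> - ?Y \<tau>) + norm (?G \<tau> - ?Y \<tau>)"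
        by (rule order_trans[OF norm_triangle_ineq4]) (intro add_right_mono norm_triangle_ineq)
      also have "\<dots> \<le> K * (L * ?m) + C1 * h ^ r + L * ?m"
        by (rule add_mono[OF add_mono[OF PGY[OF e_bound \<tau>] C1h[OF \<tau>]]
              order_trans[OF GY[OF \<tau>] mult_left_mono[OF e_bound[OF \<tau>] L0]]])
      also have "\<dots> = ((K + 1) * L * C2 * h + C1) * h ^ r" by (simp add: algebra_simps)
      also have "\<dots> \<le> C3 * h ^ r"
        unfolding C3_def using h K0 L0 C2
        by (intro mult_right_mono add_right_mono mult_left_mono) auto
      finally show ?thesis .
    qed
    show ?case using h e_bound \<delta>_bound by blast
  qed
  have stage_order: "unif_bigo {0<..<1} (\<lambda>h \<tau>. u h \<tau> - y (\<tau> * h)) (r + 1)"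
    unfolding unif_bigo_def
    by (rule exI[of _ C2], rule eventually_mono[OF stage]) (auto simp: e_def)

  \<comment> \<open>Endpoint error tested against an approximate adjoint solution\<close>
  have weighted: "\<exists>z C. (z \<longlongrightarrow> v) (at_right 0) \<and>
      (\<forall>\<^sub>F h in at_right 0. \<bar>z h \<bullet> e h 1\<bar> \<le> C * h ^ (2 * r + 1))" for v :: "real^'n"
  proof -
    have AD: "Ck_Icc h0 r (\<lambda>t. A $ i $ j + D i j t)" for i j
      unfolding D_def
      by (rule Ck_Icc_add[OF Ck_Icc_const Ck_Icc_along_solution[OF F_smooth exact(1)
              smooth_on_frechet_derivative[OF g_smooth]]])
    \<comment> \<open>Residual order \<open>r\<close> suffices: times the error of order
      \<open>r + 1\<close> and the factor \<open>h\<close> from the scaled derivative, it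
      contributes order \<open>2 * r + 2\<close>.\<close>
    obtain z z' Cz' where z0: "z 0 = v" and z_Ck: "\<And>i. Ck_Icc h0 r (\<lambda>t. z t $ i)"
      and z_der: "\<And>t. t \<in> {0..h0} \<Longrightarrow> (z has_vector_derivative z' t) (at t within {0..h0})"
      and z_res': "\<And>t j. t \<in> {0..h0} \<Longrightarrow>
        \<bar>z' t $ j + (\<Sum>i\<in>UNIV. z t $ i * (A $ i $ j + D i j t))\<bar> \<le> Cz' * t ^ r"
      by (rule adjoint_approximation[where B = "\<lambda>i j t. A $ i $ j + D i j t" and v = v and N = r, OF AD])
        blast
    define Cz where "Cz = \<bar>Cz'\<bar>"
    have z_res: "\<bar>z' t $ j + (\<Sum>i\<in>UNIV. z t $ i * (A $ i $ j + D i j t))\<bar> \<le> Cz * t ^ r"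
      if "t \<in> {0..h0}" for t j
      using z_res'[OF that, of j] mult_right_mono[OF abs_ge_self[of Cz'], of "t ^ r"] that
      unfolding Cz_def by simp
    have z_cont: "continuous_on {0..h0} z"
      by (rule continuous_on_vector_derivative[OF z_der])
    then obtain Z where Z0: "0 \<le> Z" and Z: "\<And>t. t \<in> {0..h0} \<Longrightarrow> norm (z t) \<le> Z"
      by (rule bounded_on_Icc) blast
    from projection[OF regular_scaled[OF \<open>h0 > 0\<close> z_Ck]] obtain Cp' where Cp':
      "\<forall>\<^sub>F h in at_right 0. \<forall>\<tau>\<in>{0..1}.
        norm (proj r (\<psi> h) (\<lambda>\<tau>. z (\<tau> * h)) \<tau> - z (\<tau> * h)) \<le> Cp' * h ^ r"
      unfolding unif_bigo_def by blast
    define N where "N = real CARD('n)"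
    \<comment> \<open>\<open>Cp' * C3\<close> comes from the two projection defects. The residual
      and the quadratic remainder carry surplus factors \<open>h\<close> and
      \<open>h\<^sup>2\<close>, replaced by powers of \<open>h0\<close>.\<close>
    define C where "C = Cp' * C3 + N * (Cz * C2 * h0 + Z * L2 * C2\<^sup>2 * h0\<^sup>2)"
    have "\<forall>\<^sub>F h in at_right 0. \<bar>z h \<bullet> e h 1\<bar> \<le> C * h ^ (2 * r + 1)"
      using stage Cp'
    proof eventually_elim
      case (elim h)
      then have h: "h \<in> {0<..h0}" and h_pos: "0 < h" and h_le: "h \<le> h0"
        and e_bound: "\<And>\<tau>. \<tau> \<in> {0..1} \<Longrightarrow> norm (e h \<tau>) \<le> C2 * h ^ (r + 1)"
        and \<delta>_bound: "\<And>\<tau>. \<tau> \<in> {0..1} \<Longrightarrow> norm (\<delta> h \<tau>) \<le> C3 * h ^ r"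
        by auto
      let ?z = "\<lambda>\<tau>. z (\<tau> * h)"
      have zh_cont: "continuous_on {0..1} ?z"
        by (rule continuous_on_compose2[OF z_cont]) (auto intro!: continuous_intros th h)
      have \<delta>_cont: "continuous_on {0..1} (\<delta> h)"
        unfolding \<delta>_def by (intro continuous_on_diff continuous_on_proj \<psi>_cont gu_cont h)
      \<comment> \<open>Orthogonality is the source of the doubled order: the defect of
        \<open>z\<close> supplies a second factor \<open>h ^ r\<close> besides that of
        \<open>\<delta>\<close>.\<close>
      have "integral {0..1} (\<lambda>\<tau>. ?z \<tau> \<bullet> \<delta> h \<tau>) =
          integral {0..1} (\<lambda>\<tau>. (?z \<tau> - proj r (\<psi> h) ?z \<tau>) \<bullet> \<delta> h \<tau>)"
        unfolding \<delta>_def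
        by (rule integral_inner_proj_residual[OF \<psi>_cont[OF h] _ gu_cont[OF h] zh_cont])
          (use psi_basis[OF h] in \<open>auto simp: orthonormal_basis01_def\<close>)
      also have "norm \<dots> \<le> (Cp' * h ^ r) * (C3 * h ^ r) * (1 - 0)"
      proof (rule integral_bound)
        show "continuous_on {0..1} (\<lambda>\<tau>. (?z \<tau> - proj r (\<psi> h) ?z \<tau>) \<bullet> \<delta> h \<tau>)"
          by (intro continuous_on_inner continuous_on_diff continuous_on_proj zh_cont \<psi>_cont \<delta>_cont h)
        fix \<tau> :: real assume \<tau>: "\<tau> \<in> {0..1}"
        have "norm (?z \<tau> - proj r (\<psi> h) ?z \<tau>) \<le> Cp' * h ^ r"
          using elim(2) \<tau> by (simp add: norm_minus_commute)
        then show "norm ((?z \<tau> - proj r (\<psi> h) ?z \<tau>) \<bullet> \<delta> h \<tau>) \<le> (Cp' * h ^ r) * (C3 * h ^ r)"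
          using Cauchy_Schwarz_ineq2[of "?z \<tau> - proj r (\<psi> h) ?z \<tau>" "\<delta> h \<tau>"]
            mult_mono[OF _ \<delta>_bound[OF \<tau>], of "norm (?z \<tau> - proj r (\<psi> h) ?z \<tau>)" "Cp' * h ^ r"]
            order_trans[OF norm_ge_zero, of "?z \<tau> - proj r (\<psi> h) ?z \<tau>" "Cp' * h ^ r"]
          by simp
      qed simp
      finally have int: "\<bar>integral {0..1} (\<lambda>\<tau>. ?z \<tau> \<bullet> \<delta> h \<tau>)\<bar> \<le> Cp' * C3 * h ^ (2 * r)"
        by (simp add: mult_2_right power_add mult_ac)
      have der: "(e h has_vector_derivative
          h *\<^sub>R (A *v e h \<tau> + (g (u h \<tau>) - g (y (\<tau> * h))) + \<delta> h \<tau>)) (at \<tau> within {0..1})"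
        if "\<tau> \<in> {0..1}" for \<tau>
        using e_der[OF h that] by (simp add: \<delta>_def algebra_simps)
      have rem: "\<bar>(g (u h \<tau>) - g (y (\<tau> * h))) $ i - (\<Sum>j\<in>UNIV. e h \<tau> $ j * D i j (\<tau> * h))\<bar>
          \<le> L2 * (norm (e h \<tau>))\<^sup>2" if "\<tau> \<in> {0..1}" for \<tau> i
        unfolding e_def by (rule L2[OF uX[OF h that] th[OF h that]])
      have "\<bar>z h \<bullet> e h 1\<bar> \<le> h * (Cp' * C3 * h ^ (2 * r) +
          N * (Cz * h ^ r * (C2 * h ^ (r + 1)) + Z * L2 * (C2 * h ^ (r + 1))\<^sup>2))"
        unfolding N_def
        by (rule weighted_endpoint_bound[OF h_pos h_le e0[OF h] der z_der z_res rem Z e_bound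
              _ L20 \<delta>_cont int]) (simp_all add: Cz_def)
      also have "\<dots> = (Cp' * C3 + N * (Cz * C2 * h + Z * L2 * C2\<^sup>2 * h\<^sup>2)) * h ^ (2 * r + 1)"
      proof -
        have "h ^ (2 * r) = h ^ r * h ^ r" "h ^ (2 * r + 1) = h * (h ^ r * h ^ r)" "h ^ (r + 1) = h * h ^ r"
          by (simp_all add: mult_2 power_add)
        then show ?thesis by (simp only:) (simp add: power2_eq_square algebra_simps)
      qed
      also have "\<dots> \<le> C * h ^ (2 * r + 1)"
        unfolding C_def using h_pos h_le C2 L20 Z0
        by (intro mult_right_mono add_left_mono mult_left_mono add_mono power_mono)
          (auto simp: N_def Cz_def)
      finally show ?case .
    qed
    moreover have "(z \<longlongrightarrow> v) (at_right 0)"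
      using continuous_on_Icc_at_rightD[OF z_cont \<open>h0 > 0\<close>] by (simp add: z0)
    ultimately show ?thesis by blast
  qed

  \<comment> \<open>From the tested errors to the norm of the endpoint error\<close>
  define \<epsilon> where "\<epsilon> = 1 / (2 * real CARD('n))"
  have \<epsilon>: "0 < \<epsilon>" by (simp add: \<epsilon>_def)
  have "\<forall>i. \<exists>C. \<forall>\<^sub>F h in at_right 0. \<bar>e h 1 $ i\<bar> \<le> C * h ^ (2 * r + 1) + \<epsilon> * norm (e h 1)"
  proof
    fix i
    obtain z C where z: "(z \<longlongrightarrow> axis i 1) (at_right 0)"
      and C: "\<forall>\<^sub>F h in at_right 0. \<bar>z h \<bullet> e h 1\<bar> \<le> C * h ^ (2 * r + 1)"
      using weighted by blast
    have "\<forall>\<^sub>F h in at_right 0. \<bar>e h 1 $ i\<bar> \<le> C * h ^ (2 * r + 1) + \<epsilon> * norm (e h 1)"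
      using tendstoD[OF z \<epsilon>] C
    proof eventually_elim
      case (elim h)
      \<comment> \<open>The adjoint function equals the unit vector only at time 0; for small
        \<open>h\<close> its value \<open>z h\<close> differs from it by less than
        \<open>\<epsilon>\<close>.\<close>
      have "e h 1 $ i = z h \<bullet> e h 1 - (z h - axis i 1) \<bullet> e h 1"
        by (simp add: inner_diff_left inner_axis')
      moreover have "\<bar>(z h - axis i 1) \<bullet> e h 1\<bar> \<le> \<epsilon> * norm (e h 1)"
        using elim(1) mult_right_mono[of "norm (z h - axis i 1)" \<epsilon> "norm (e h 1)"]
        by (intro order_trans[OF Cauchy_Schwarz_ineq2]) (simp add: dist_norm)
      ultimately show ?case using elim(2) by linarith
    qed
    then show "\<exists>C. \<forall>\<^sub>F h in at_right 0. \<bar>e h 1 $ i\<bar> \<le> C * h ^ (2 * r + 1) + \<epsilon> * norm (e h 1)" ..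
  qed
  from choice[OF this] obtain C where
    "\<And>i. \<forall>\<^sub>F h in at_right 0. \<bar>e h 1 $ i\<bar> \<le> C i * h ^ (2 * r + 1) + \<epsilon> * norm (e h 1)" by blast
  then have "\<forall>\<^sub>F h in at_right 0. \<forall>i. \<bar>e h 1 $ i\<bar> \<le> C i * h ^ (2 * r + 1) + \<epsilon> * norm (e h 1)"
    by (rule eventually_all_finite)
  then have "\<forall>\<^sub>F h in at_right 0. norm (norm (u h 1 - y h)) \<le> (2 * (\<Sum>i\<in>UNIV. C i)) * norm (h ^ (2 * r + 1))"
    using eventually_at_right_0_le[OF \<open>h0 > 0\<close>]
  proof eventually_elim
    case (elim h)
    have "norm (e h 1) \<le> (\<Sum>i\<in>UNIV. \<bar>e h 1 $ i\<bar>)" by (rule norm_le_l1_cart)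
    also have "\<dots> \<le> (\<Sum>i\<in>UNIV. C i * h ^ (2 * r + 1) + \<epsilon> * norm (e h 1))"
      using elim(1) by (intro sum_mono) auto
    \<comment> \<open>By the choice of \<open>\<epsilon>\<close> the perturbations of all components
      add up to half the norm, which is absorbed on the left; this explains the factor 2 in the
      final constant.\<close>
    also have "\<dots> = (\<Sum>i\<in>UNIV. C i) * h ^ (2 * r + 1) + norm (e h 1) / 2"
      by (simp add: sum.distrib sum_distrib_right \<epsilon>_def)
    finally show ?case using elim(2) by (simp add: e_def)
  qed
  then have "(\<lambda>h. norm (u h 1 - y h)) \<in> O[at_right 0](\<lambda>h. h ^ (2 * r + 1))"
    by (rule bigoI)
  with stage_order show ?thesis ..
qed

end
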